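(* For every $\varphi\in L^2(0,1)\setminus\{0\}$ with $\varphi\ge0$ and every $u\in[0,1)$, $$\lim_{L\to+\infty}\frac1L\ln\big[\mathcal T_\varphi(L,u)\big]=-\Lambda_\infty,$$ where $$\Lambda_\infty=\inf_{\varphi\in\mathcal D}\int_0^1a_\infty(v)\varphi'(v)^2dv>0$$ and $$\mathcal D=\Big\{\varphi\in\mathcal C^\infty([0,1]):\ \|\varphi\|_{L^2(0,1)}=1,\ \varphi'(0)=0,\ \varphi(1)=0\Big\}.$$
   Context: Fix $d>0$, $n_1>1$, $a>0$, $\theta=\sqrt{1-1/n_1^2}$, and a Lipschitz function $\gamma_0:[0,d]^2\to\mathbb R$ that is the kernel of a nonnegative operator on $L^2(0,d)$, with $$S_0=\int_0^d\int_0^d\gamma_0(x_1,x_2)\cos\big(\tfrac\pi dx_1\big)\cos\big(\tfrac\pi dx_2\big)dx_1dx_2>0.$$ For $u\in[0,1]$ let $$a_\infty(u)=\frac{a_0}{1-\big(1-\frac{\pi^2}{a^2d^2}\big)(\theta u)^2},\qquad a_0=\frac{\pi^2S_0}{2a\,n_1^4d^4\theta^2}.$$ For $\varphi\in L^2(0,1)$, $\mathcal T_\varphi$ is the solution of $$\partial_z\mathcal T_\varphi(z,u)=\partial_u\big(a_\infty(u)\,\partial_u\mathcal T_\varphi(z,u)\big),\quad (z,u)\in(0,\infty)\times(0,1),$$ with $\partial_u\mathcal T_\varphi(z,0)=0$, $\mathcal T_\varphi(z,1)=0$ for all $z>0$, and $\mathcal T_\varphi(0,\cdot)=\varphi$ (continuous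 in $z\ge0$ with values in $L^2(0,1)$; for $z>0$ a classical solution, so pointwise values make sense). *)

theory Defs
  imports "HOL-Analysis.Analysis"
begin

text \<open>
  Elements of \<open>L\<^sup>2(A)\<close> are represented by functions; equality and sign conditions on them are
  meant almost everywhere.
\<close>

definition L2_on :: "real set \<Rightarrow> (real \<Rightarrow> real) set" where
  "L2_on A = {f \<in> borel_measurable (lebesgue_on A). integrable (lebesgue_on A) (\<lambda>x. (f x)\<^sup>2)}"

definition L2_norm_on :: "real set \<Rightarrow> (real \<Rightarrow> real) \<Rightarrow> real" where
  "L2_norm_on A f = sqrt (\<integral>x. (f x)\<^sup>2 \<partial>lebesgue_on A)"

definition kernel_operator :: "real \<Rightarrow> (real \<times> real \<Rightarrow> real) \<Rightarrow> (real \<Rightarrow> real) \<Rightarrow> real \<Rightarrow> real" where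
  "kernel_operator d \<gamma> f x = (\<integral>y. \<gamma> (x, y) * f y \<partial>lebesgue_on {0<..<d})"

definition nonneg_kernel :: "real \<Rightarrow> (real \<times> real \<Rightarrow> real) \<Rightarrow> bool" where
  "nonneg_kernel d \<gamma> \<longleftrightarrow>
     (\<forall>f \<in> L2_on {0<..<d}. 0 \<le> (\<integral>x. kernel_operator d \<gamma> f x * f x \<partial>lebesgue_on {0<..<d}))"

definition S0 :: "real \<Rightarrow> (real \<times> real \<Rightarrow> real) \<Rightarrow> real" where
  "S0 d \<gamma> = (\<integral>x\<^sub>1. (\<integral>x\<^sub>2. \<gamma> (x\<^sub>1, x\<^sub>2) * cos (pi / d * x\<^sub>1) * cos (pi / d * x\<^sub>2)
      \<partial>lebesgue_on {0..d}) \<partial>lebesgue_on {0..d})"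

definition theta :: "real \<Rightarrow> real" where
  "theta n\<^sub>1 = sqrt (1 - 1 / n\<^sub>1\<^sup>2)"

definition a0 :: "real \<Rightarrow> real \<Rightarrow> real \<Rightarrow> (real \<times> real \<Rightarrow> real) \<Rightarrow> real" where
  "a0 d n\<^sub>1 a \<gamma> = pi\<^sup>2 * S0 d \<gamma> / (2 * a * n\<^sub>1 ^ 4 * d ^ 4 * (theta n\<^sub>1)\<^sup>2)"

definition a_infty :: "real \<Rightarrow> real \<Rightarrow> real \<Rightarrow> (real \<times> real \<Rightarrow> real) \<Rightarrow> real \<Rightarrow> real" where
  "a_infty d n\<^sub>1 a \<gamma> u =
     a0 d n\<^sub>1 a \<gamma> / (1 - (1 - pi\<^sup>2 / (a\<^sup>2 * d\<^sup>2)) * (theta n\<^sub>1 * u)\<^sup>2)"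

text \<open>
  Classical solutions of \<open>\<partial>\<^sub>z T = \<partial>\<^sub>u (A \<partial>\<^sub>u T)\<close> on \<open>(0,\<infinity>) \<times> (0,1)\<close> with a Neumann condition at
  \<open>u = 0\<close>, a Dirichlet condition at \<open>u = 1\<close> and initial value \<open>\<phi>\<close>. Here \<open>Tu\<close> and \<open>Tz\<close> are the
  partial derivatives; continuity up to the boundary is required only of the quantities that
  the boundary conditions prescribe: of \<open>T\<close> up to \<open>u = 1\<close> and of \<open>Tu\<close> up to \<open>u = 0\<close>. The
  initial value is attained in \<open>L\<^sup>2(0,1)\<close>.
\<close>

definition diffusion_solution ::
    "(real \<Rightarrow> real) \<Rightarrow> (real \<Rightarrow> real) \<Rightarrow> (real \<Rightarrow> real \<Rightarrow> real) \<Rightarrow> bool" where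
  "diffusion_solution A \<phi> T \<longleftrightarrow>
     (\<exists>Tu Tz.
        continuous_on ({0<..} \<times> {0..1}) (\<lambda>(z, u). T z u) \<and>
        continuous_on ({0<..} \<times> {0..<1}) (\<lambda>(z, u). Tu z u) \<and>
        continuous_on ({0<..} \<times> {0<..<1}) (\<lambda>(z, u). Tz z u) \<and>
        (\<forall>z>0. \<forall>u\<in>{0..<1}. (T z has_real_derivative Tu z u) (at u within {0..1})) \<and>
        (\<forall>z>0. \<forall>u\<in>{0<..<1}. ((\<lambda>s. T s u) has_real_derivative Tz z u) (at z)) \<and>
        (\<forall>z>0. \<forall>u\<in>{0<..<1}. ((\<lambda>v. A v * Tu z v) has_real_derivative Tz z u) (at u)) \<and>
        (\<forall>z>0. Tu z 0 = 0)) \<and>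
     (\<forall>z>0. T z 1 = 0) \<and>
     (AE u in lebesgue_on {0<..<1}. T 0 u = \<phi> u) \<and>
     (\<forall>z\<ge>0. T z \<in> L2_on {0<..<1}) \<and>
     (\<forall>z\<^sub>0\<ge>0. ((\<lambda>z. L2_norm_on {0<..<1} (\<lambda>u. T z u - T z\<^sub>0 u)) \<longlongrightarrow> 0) (at z\<^sub>0 within {0..}))"

text \<open>\<open>\<C>\<^sup>\<infinity>([0,1])\<close>: derivatives of all orders on the closed interval, one-sided at its ends.\<close>

definition smooth_01 :: "(real \<Rightarrow> real) \<Rightarrow> bool" where
  "smooth_01 \<phi> \<longleftrightarrow>
     (\<exists>D :: nat \<Rightarrow> real \<Rightarrow> real. D 0 = \<phi> \<and>
        (\<forall>n. \<forall>x\<in>{0..1}. (D n has_real_derivative D (Suc n) x) (at x within {0..1})))"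

abbreviation deriv_01 :: "(real \<Rightarrow> real) \<Rightarrow> real \<Rightarrow> real" where
  "deriv_01 \<phi> x \<equiv> vector_derivative \<phi> (at x within {0..1})"

definition test_functions :: "(real \<Rightarrow> real) set" where
  "test_functions =
     {\<phi>. smooth_01 \<phi> \<and> L2_norm_on {0<..<1} \<phi> = 1 \<and> deriv_01 \<phi> 0 = 0 \<and> \<phi> 1 = 0}"

definition Lambda_infty :: "(real \<Rightarrow> real) \<Rightarrow> real" where
  "Lambda_infty A = (INF \<phi>\<in>test_functions. \<integral>v. A v * (deriv_01 \<phi> v)\<^sup>2 \<partial>lebesgue_on {0..1})"

end

theory Submission
  imports Defs
begin

text \<open>
  Let \<open>A\<close> be the diffusivity, so that \<open>1 / A\<close> is a polynomial, and let \<open>Phi L\<close> solve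
  \<open>(A Phi')' = - L Phi\<close> with \<open>Phi(0) = 1\<close>, \<open>Phi'(0) = 0\<close>. Let \<open>\<Lambda>\<close> be the least \<open>L\<close> for which
  \<open>Phi L\<close> has a zero in \<open>[0,1]\<close>. Then \<open>Phi \<Lambda>\<close> is positive on \<open>[0,1)\<close> and vanishes at 1, and
  \<open>\<Lambda>\<close> is the infimum of the Rayleigh quotient: Jacobi's identity with the positive \<open>Phi L\<close>,
  \<open>L < \<Lambda>\<close>, gives the lower bound, and \<open>Phi \<Lambda>\<close> attains it.

  A solution \<open>T\<close> is nonnegative since a convex \<open>L\<^sup>2\<close>-type functional of its negative part does not
  increase in \<open>z\<close> and tends to 0 as \<open>z\<close> does. Comparison with travelling waves
  \<open>exp (l u + \<sigma> z) - 1\<close> turns positivity at one point into \<open>T(z\<^sub>0, u) \<ge> c (1 - u)\<close> at some later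
  \<open>z\<^sub>0\<close>. Hence \<open>T\<close> stays above a multiple of \<open>exp (- \<Lambda> z) Phi \<Lambda>\<close>, and for every \<open>L < \<Lambda>\<close> it
  stays below a multiple of \<open>exp (- L z) Phi L\<close>, which is positive up to the boundary.
\<close>

subsection \<open>Calculus on the unit interval\<close>

lemma mvt_unit_interval:
  fixes f f' :: "real \<Rightarrow> real"
  assumes "\<And>x. x \<in> {0..1} \<Longrightarrow> (f has_real_derivative f' x) (at x within {0..1})"
    and "0 \<le> a" "a < b" "b \<le> 1"
  obtains x where "a < x" "x < b" "f b - f a = (b - a) * f' x"
proof -
  have "(f has_derivative (\<lambda>h. f' x * h)) (at x within {a..b})" if "a \<le> x" "x \<le> b" for x
    using assms that by (intro has_field_derivative_imp_has_derivative DERIV_subset[OF assms(1)]) auto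
  from mvt_simple[OF \<open>a < b\<close> this] show ?thesis using that by (auto simp: mult.commute)
qed

lemma deriv_01_eq:
  assumes "(f has_real_derivative f') (at x within {0..1})" "x \<in> {0..1}"
  shows "deriv_01 f x = f'"
  using vector_derivative_within_cbox[of 0 1 x f f'] assms
  by (simp add: has_real_derivative_iff_has_vector_derivative)

lemma integrable_lebesgue_on_mono:
  fixes f :: "'a::euclidean_space \<Rightarrow> real"
  assumes "integrable (lebesgue_on T) f" "S \<subseteq> T" "S \<in> sets lebesgue" "T \<in> sets lebesgue"
  shows "integrable (lebesgue_on S) f"
proof -
  have "set_integrable lebesgue T f"
    using assms by (simp add: integrable_restrict_space set_integrable_def)
  then have "set_integrable lebesgue S f" using assms(3,2) by (rule set_integrable_subset)
  then show ?thesis using assms by (simp add: integrable_restrict_space set_integrable_def)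
qed

lemma lebesgue_on_eq_integral:
  fixes f :: "real \<Rightarrow> real"
  assumes "continuous_on {0..1} f"
  shows "(\<integral>x. f x \<partial>lebesgue_on {0..1}) = integral {0..1} f"
    and "(\<integral>x. f x \<partial>lebesgue_on {0<..<1}) = integral {0..1} f"
proof -
  have i: "integrable (lebesgue_on {0..1}) f" using assms by (rule continuous_imp_integrable_real)
  then show "(\<integral>x. f x \<partial>lebesgue_on {0..1}) = integral {0..1} f"
    by (intro lebesgue_integral_eq_integral) auto
  have "integrable (lebesgue_on {0<..<1}) f"
    using i by (rule integrable_lebesgue_on_mono) auto
  then have "(\<integral>x. f x \<partial>lebesgue_on {0<..<1}) = integral {0<..<1} f"
    by (intro lebesgue_integral_eq_integral) auto
  then show "(\<integral>x. f x \<partial>lebesgue_on {0<..<1}) = integral {0..1} f"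
    by (simp add: integral_open_interval_real)
qed

lemma L2_on_diff_integrable:
  assumes "f \<in> L2_on S" "g \<in> L2_on S"
  shows "integrable (lebesgue_on S) (\<lambda>x. (f x - g x)\<^sup>2)"
proof (rule Bochner_Integration.integrable_bound)
  show "integrable (lebesgue_on S) (\<lambda>x. 2 * (f x)\<^sup>2 + 2 * (g x)\<^sup>2)"
    using assms by (auto simp: L2_on_def)
  show "(\<lambda>x. (f x - g x)\<^sup>2) \<in> borel_measurable (lebesgue_on S)"
    using assms unfolding L2_on_def by (intro borel_measurable_power borel_measurable_diff) auto
  have "(a - b)\<^sup>2 \<le> 2 * a\<^sup>2 + 2 * b\<^sup>2" for a b :: real
    using zero_le_power2[of "a + b"] by (simp add: power2_eq_square algebra_simps)
  then show "AE x in lebesgue_on S. norm ((f x - g x)\<^sup>2) \<le> norm (2 * (f x)\<^sup>2 + 2 * (g x)\<^sup>2)"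
    by (auto intro!: always_eventually)
qed

text \<open>At 0 the difference quotient of the cut function is dominated by that of
  \<open>f\<close>, which tends to \<open>f' 0 = 0\<close>. Applied twice, this makes
  \<open>neg_part\<close> twice differentiable.\<close>

lemma DERIV_cut_nonpos:
  fixes f f' :: "real \<Rightarrow> real"
  assumes "\<And>y. (f has_real_derivative f' y) (at y)" "f 0 = 0" "f' 0 = 0"
  shows "((\<lambda>y. if y \<le> 0 then f y else 0) has_real_derivative (if y \<le> 0 then f' y else 0)) (at y)"
proof -
  let ?F = "\<lambda>y. if y \<le> 0 then f y else 0"
  consider "y < 0" | "y = 0" | "0 < y" by linarith
  then show ?thesis
  proof cases
    case 1
    then have "(?F has_real_derivative f' y) (at y)"
      by (intro has_field_derivative_transform_within_open[OF assms(1), of "{..<0}"]) auto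
    then show ?thesis using 1 by simp
  next
    case 3
    then have "(?F has_real_derivative 0) (at y)"
      by (intro has_field_derivative_transform_within_open[OF DERIV_const, of "{0<..}"]) auto
    then show ?thesis using 3 by simp
  next
    case 2
    have "(\<lambda>h. f h / h) \<midarrow>0\<rightarrow> 0" using assms(1)[of 0] assms(2,3) by (simp add: DERIV_def)
    then have "(\<lambda>h. ?F h / h) \<midarrow>0\<rightarrow> 0"
      by (rule tendsto_0_le[where K = 1]) (auto intro: always_eventually)
    moreover have "(\<lambda>h. ?F h / h) = (\<lambda>h. (?F (0 + h) - ?F 0) / h)" using assms(2) by (simp cong: if_cong)
    ultimately show ?thesis unfolding 2 DERIV_def using assms(3) by simp
  qed
qed

text \<open>Jacobi's identity \<open>A \<psi>'\<^sup>2 - L \<psi>\<^sup>2 - A (\<psi>' - \<psi> \<chi>' / \<chi>)\<^sup>2 = (\<psi>\<^sup>2 A \<chi>' / \<chi>)'\<close>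
  for \<open>(A \<chi>')' = - L \<chi>\<close>, pointwise: \<open>p = 1 / A\<close>, \<open>s = \<psi>\<close>, \<open>t = \<psi>'\<close>, \<open>c = \<chi>\<close>, \<open>w = A \<chi>'\<close>.\<close>

lemma jacobi_identity:
  fixes c p :: real
  assumes "c \<noteq> 0" "p \<noteq> 0"
  shows "1 / p * t\<^sup>2 - L * s\<^sup>2 - 1 / p * (t - p * s * w / c)\<^sup>2 =
    ((2 * s * t * w + s\<^sup>2 * (- L * c)) * c - s\<^sup>2 * w * (p * w)) / (c * c)"
proof -
  define k where "k = w / c"
  have w: "w = k * c" using assms by (simp add: k_def)
  have "1 / p * (t - p * s * w / c)\<^sup>2 = 1 / p * t\<^sup>2 - 2 * s * t * k + p * s\<^sup>2 * k\<^sup>2"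
    using assms unfolding w by (simp add: power2_eq_square divide_simps) (simp add: algebra_simps)
  moreover have "(2 * s * t * w + s\<^sup>2 * (- L * c)) * c - s\<^sup>2 * w * (p * w)
      = (2 * s * t * k - L * s\<^sup>2 - p * s\<^sup>2 * k\<^sup>2) * (c * c)"
    unfolding w by (simp add: power2_eq_square algebra_simps)
  ultimately show ?thesis using assms by simp
qed

subsection \<open>The principal eigenvalue\<close>

text \<open>The equation is carried by \<open>r = 1 / A\<close> instead of the diffusivity
  \<open>A\<close>: for the diffusivity at hand \<open>r\<close> is a polynomial, which makes the
  smoothness of the eigenfunction an algebraic matter (\<open>smooth_Phi\<close>).\<close>

locale sturm_liouville =
  fixes r :: "real poly"
  assumes r_pos: "u \<in> {0..1} \<Longrightarrow> 0 < poly r u"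
begin

text \<open>Coefficients of the shooting solution expanded in powers of \<open>- L\<close>: with
  \<open>A = 1 / r\<close> they satisfy \<open>(A phi_(k+1)')' = phi_k\<close>, and
  \<open>psi k\<close> is the flux \<open>A phi_(k+1)'\<close>.\<close>

fun phi :: "nat \<Rightarrow> real \<Rightarrow> real" where
  "phi 0 u = 1"
| "phi (Suc k) u = integral {0..u} (\<lambda>s. poly r s * integral {0..s} (phi k))"

definition psi :: "nat \<Rightarrow> real \<Rightarrow> real" where
  "psi k u = integral {0..u} (phi k)"

lemma r_bound: obtains M where "\<And>u. u \<in> {0..1} \<Longrightarrow> poly r u \<le> M" and "0 < M"
proof -
  have "compact (poly r ` {0..1})"
    by (intro compact_continuous_image continuous_intros) auto
  then obtain M where "\<And>u. u \<in> {0..1} \<Longrightarrow> \<bar>poly r u\<bar> \<le> M"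
    by (metis compact_imp_bounded bounded_iff image_eqI real_norm_def)
  then show ?thesis using r_pos[of 0] by (intro that[of M]) (force simp: abs_le_iff)+
qed

text \<open>Continuity of \<open>phi k\<close> is a premise because the induction for
  \<open>phi_cont\<close> uses this lemma; \<open>psi_deriv\<close> is the version with the premise
  discharged.\<close>

lemma psi_deriv_of_cont:
  assumes "continuous_on {0..1} (phi k)" "u \<in> {0..1}"
  shows "(psi k has_real_derivative phi k u) (at u within {0..1})"
  using integral_has_real_derivative[OF assms] unfolding psi_def .

lemma phi_cont: "continuous_on {0..1} (phi k)"
proof (induction k)
  case 0
  show ?case by simp
next
  case (Suc k)
  have "continuous_on {0..1} (psi k)"
    using psi_deriv_of_cont[OF Suc] by (rule DERIV_continuous_on)
  then have "continuous_on {0..1} (\<lambda>s. poly r s * psi k s)"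
    by (intro continuous_intros)
  from integral_has_real_derivative[OF this]
  have "continuous_on {0..1} (\<lambda>u. integral {0..u} (\<lambda>s. poly r s * psi k s))"
    by (rule DERIV_continuous_on)
  moreover have "phi (Suc k) = (\<lambda>u. integral {0..u} (\<lambda>s. poly r s * psi k s))"
    by (simp add: fun_eq_iff psi_def)
  ultimately show ?case by simp
qed

lemmas psi_deriv = psi_deriv_of_cont[OF phi_cont]

lemma psi_cont: "continuous_on {0..1} (psi k)"
  using psi_deriv by (rule DERIV_continuous_on)

lemma phi_Suc_deriv:
  assumes "u \<in> {0..1}"
  shows "(phi (Suc k) has_real_derivative poly r u * psi k u) (at u within {0..1})"
proof -
  have "continuous_on {0..1} (\<lambda>s. poly r s * psi k s)"
    using psi_cont by (intro continuous_intros)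
  from integral_has_real_derivative[OF this assms]
  have "((\<lambda>u. integral {0..u} (\<lambda>s. poly r s * psi k s)) has_real_derivative poly r u * psi k u) (at u within {0..1})" .
  moreover have "phi (Suc k) = (\<lambda>u. integral {0..u} (\<lambda>s. poly r s * psi k s))"
    by (simp add: fun_eq_iff psi_def)
  ultimately show ?thesis by simp
qed

text \<open>Each step integrates twice and multiplies by \<open>r\<close>, which is at most
  \<open>M\<close>. The outer integration supplies the factor \<open>u / (k + 1)\<close>; for the
  inner one \<open>u \<le> 1\<close> suffices. The factorial makes the series converge for every
  \<open>L\<close>.\<close>

lemma phi_psi_bound:
  assumes M: "\<And>u. u \<in> {0..1} \<Longrightarrow> poly r u \<le> M" "0 < M" and "u \<in> {0..1}"
  shows "\<bar>phi k u\<bar> \<le> M ^ k * u ^ k / fact k" "\<bar>psi k u\<bar> \<le> M ^ k * u ^ k / fact k"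
proof -
  have step: "\<bar>psi k u\<bar> \<le> M ^ k * u ^ k / fact k"
    if IH: "\<And>u. u \<in> {0..1} \<Longrightarrow> \<bar>phi k u\<bar> \<le> M ^ k * u ^ k / fact k" and u: "u \<in> {0..1}" for k u
  proof -
    have "norm (psi k u) \<le> M ^ k * u ^ k / fact k * (u - 0)"
      unfolding psi_def
    proof (rule integral_bound)
      show "continuous_on {0..u} (phi k)"
        using phi_cont by (rule continuous_on_subset) (use u in auto)
      fix t assume t: "t \<in> {0..u}"
      have "\<bar>phi k t\<bar> \<le> M ^ k * t ^ k / fact k" using IH t u by auto
      also have "\<dots> \<le> M ^ k * u ^ k / fact k"
        using t M(2) by (intro divide_right_mono mult_left_mono power_mono) auto
      finally show "norm (phi k t) \<le> M ^ k * u ^ k / fact k" by simp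
    qed (use u in auto)
    also have "\<dots> \<le> M ^ k * u ^ k / fact k"
      using u M(2) by (intro mult_left_le) auto
    finally show ?thesis by simp
  qed
  have phi: "\<bar>phi k u\<bar> \<le> M ^ k * u ^ k / fact k" if "u \<in> {0..1}" for k u
    using that
  proof (induction k arbitrary: u)
    case (Suc k)
    have sub: "{0..u} \<subseteq> {0..1}" using Suc.prems by auto
    define g where "g = (\<lambda>s. M * (M ^ k * s ^ k / fact k))"
    have g: "(g has_integral (M ^ Suc k * u ^ Suc k / fact (Suc k) - M ^ Suc k * 0 ^ Suc k / fact (Suc k))) {0..u}"
    proof (rule fundamental_theorem_of_calculus)
      fix x :: real
      have "((\<lambda>s. M ^ Suc k * s ^ Suc k / fact (Suc k)) has_real_derivative
         M ^ Suc k * (real (Suc k) * x ^ k) / fact (Suc k)) (at x within {0..u})"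
        by (intro derivative_eq_intros refl) auto
      also have "M ^ Suc k * (real (Suc k) * x ^ k) / fact (Suc k) = g x"
        unfolding g_def by (simp add: field_simps del: of_nat_Suc)
      finally show "((\<lambda>s. M ^ Suc k * s ^ Suc k / fact (Suc k)) has_vector_derivative g x) (at x within {0..u})"
        by (simp add: has_real_derivative_iff_has_vector_derivative)
    qed (use Suc.prems in auto)
    have "norm (integral {0..u} (\<lambda>s. poly r s * psi k s)) \<le> integral {0..u} g"
    proof (rule integral_norm_bound_integral)
      show "(\<lambda>s. poly r s * psi k s) integrable_on {0..u}"
        using psi_cont sub
        by (intro integrable_continuous_real continuous_intros) (rule continuous_on_subset)
      show "g integrable_on {0..u}" using g by blast
      fix s assume "s \<in> {0..u}"
      then have s: "s \<in> {0..1}" using sub by auto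
      have "\<bar>psi k s\<bar> \<le> M ^ k * s ^ k / fact k" using step Suc.IH s by blast
      then show "norm (poly r s * psi k s) \<le> g s"
        using M(1)[OF s] r_pos[OF s] M(2) mult_mono[of "poly r s" M "\<bar>psi k s\<bar>" "M ^ k * s ^ k / fact k"]
        unfolding g_def by (simp add: abs_mult)
    qed
    then show ?case using g by (simp add: integral_unique psi_def)
  qed auto
  show "\<bar>phi k u\<bar> \<le> M ^ k * u ^ k / fact k" "\<bar>psi k u\<bar> \<le> M ^ k * u ^ k / fact k"
    using phi step assms(3) by blast+
qed

text \<open>Shooting from \<open>u = 0\<close>: summing the Picard iteration gives \<open>Phi L\<close> with
  \<open>Phi L 0 = 1\<close>, \<open>(Phi L)' = r W\<close>, \<open>W' = - L Phi L\<close>, i.e. \<open>(A (Phi L)')' = - L Phi L\<close> for \<open>A = 1 / r\<close>.\<close>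

definition Phi :: "real \<Rightarrow> real \<Rightarrow> real" where
  "Phi L u = (\<Sum>k. (-L) ^ k * phi k u)"

definition W :: "real \<Rightarrow> real \<Rightarrow> real" where
  "W L u = (\<Sum>k. (-L) ^ Suc k * psi k u)"

text \<open>One majorant serves both series and their termwise derivatives, uniformly in
  \<open>L\<close>. The factor \<open>(1 + R) * (1 + M)\<close> in \<open>B\<close> absorbs the
  additional factors \<open>L\<close> and \<open>poly r u\<close>.\<close>

lemma term_bounds:
  assumes "0 < R"
  obtains B where "summable B"
    "\<And>k L u. L \<in> {-R..R} \<Longrightarrow> u \<in> {0..1} \<Longrightarrow> norm ((-L) ^ k * phi k u) \<le> B k"
    "\<And>k L u. L \<in> {-R..R} \<Longrightarrow> u \<in> {0..1} \<Longrightarrow> norm ((-L) ^ Suc k * phi k u) \<le> B k"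
    "\<And>k L u. L \<in> {-R..R} \<Longrightarrow> u \<in> {0..1} \<Longrightarrow> norm ((-L) ^ Suc k * psi k u) \<le> B k"
    "\<And>k L u. L \<in> {-R..R} \<Longrightarrow> u \<in> {0..1} \<Longrightarrow> norm ((-L) ^ Suc k * (poly r u * psi k u)) \<le> B k"
proof -
  obtain M where M: "\<And>u. u \<in> {0..1} \<Longrightarrow> poly r u \<le> M" "0 < M" using r_bound by blast
  define B where "B k = (1 + R) * (1 + M) * ((R * M) ^ k / fact k)" for k
  have "summable (\<lambda>k. (R * M) ^ k / fact k)"
    using summable_exp[of "R * M"] by (simp add: divide_inverse mult.commute)
  then have 1: "summable B" unfolding B_def by (rule summable_mult)
  have *: "\<bar>L\<bar> ^ k * \<bar>x\<bar> \<le> (R * M) ^ k / fact k"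
    if "L \<in> {-R..R}" "u \<in> {0..1}" "\<bar>x\<bar> \<le> M ^ k * u ^ k / fact k" for L u x k
  proof -
    have "M ^ k * u ^ k / fact k \<le> M ^ k / fact k"
      using that M(2) by (intro divide_right_mono mult_left_le power_le_one) auto
    then have "\<bar>L\<bar> ^ k * \<bar>x\<bar> \<le> R ^ k * (M ^ k / fact k)"
      using that assms by (intro mult_mono power_mono) auto
    then show ?thesis by (simp add: power_mult_distrib)
  qed
  have **: "\<bar>L\<bar> ^ k * \<bar>x\<bar> * c \<le> B k"
    if "L \<in> {-R..R}" "u \<in> {0..1}" "\<bar>x\<bar> \<le> M ^ k * u ^ k / fact k" "0 \<le> c" "c \<le> (1+R)*(1+M)" for L u x c k
  proof -
    have "c * (\<bar>L\<bar> ^ k * \<bar>x\<bar>) \<le> (1+R)*(1+M) * ((R * M) ^ k / fact k)"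
      using that * by (intro mult_mono) auto
    then show ?thesis unfolding B_def by (simp add: mult_ac)
  qed
  show ?thesis
  proof (rule that[OF 1])
    fix k L u assume L: "L \<in> {-R..R}" and u: "u \<in> {0..(1::real)}"
    note b = phi_psi_bound[OF M u, of k]
    have c: "1 \<le> (1+R)*(1+M)" "\<bar>L\<bar> \<le> (1+R)*(1+M)" "\<bar>L\<bar> * poly r u \<le> (1+R)*(1+M)"
    proof -
      have "0 < R * M" using M assms by simp
      then have le: "1 + R \<le> (1+R)*(1+M)" using M assms by (simp add: algebra_simps)
      show "1 \<le> (1+R)*(1+M)" "\<bar>L\<bar> \<le> (1+R)*(1+M)"
        by (rule order_trans[OF _ le]; use assms L in auto)+
      have "\<bar>L\<bar> * poly r u \<le> (1+R)*(1+M)" using L r_pos[OF u] order_trans[OF M(1)[OF u], of "1 + M"] assms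
        by (intro mult_mono) auto
      then show "\<bar>L\<bar> * poly r u \<le> (1+R)*(1+M)" .
    qed
    show "norm ((-L) ^ k * phi k u) \<le> B k"
      using **[OF L u b(1), of 1] c by (simp add: abs_mult power_abs)
    show "norm ((-L) ^ Suc k * phi k u) \<le> B k"
      using **[OF L u b(1), of "\<bar>L\<bar>"] c by (simp add: abs_mult power_abs mult_ac)
    show "norm ((-L) ^ Suc k * psi k u) \<le> B k"
      using **[OF L u b(2), of "\<bar>L\<bar>"] c by (simp add: abs_mult power_abs mult_ac)
    show "norm ((-L) ^ Suc k * (poly r u * psi k u)) \<le> B k"
      using **[OF L u b(2), of "\<bar>L\<bar> * poly r u"] c r_pos[OF u] by (simp add: abs_mult power_abs mult_ac)
  qed
qed

text \<open>Joint continuity makes the set of pairs \<open>(L, u)\<close> with a nonpositive value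
  compact; the first zero is taken from that set.\<close>

lemma Phi_continuous:
  assumes "0 < R"
  shows "continuous_on ({0..R} \<times> {0..1}) (\<lambda>(L, u). Phi L u)"
proof -
  obtain B where B: "summable B"
    "\<And>k L u. L \<in> {-R..R} \<Longrightarrow> u \<in> {0..1} \<Longrightarrow> norm ((-L) ^ k * phi k u) \<le> B k"
    using term_bounds[OF assms] by metis
  have "uniform_limit ({0..R} \<times> {0..1}) (\<lambda>n x. \<Sum>i<n. (\<lambda>(L,u). (-L) ^ i * phi i u) x)
      (\<lambda>x. suminf (\<lambda>i. (\<lambda>(L,u). (-L) ^ i * phi i u) x)) sequentially"
    using B assms by (intro Weierstrass_m_test[where M=B]) auto
  moreover have "continuous_on ({0..R} \<times> {0..1}) (\<lambda>x. \<Sum>i<n. (\<lambda>(L,u). (-L) ^ i * phi i u) x)" for n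
    unfolding case_prod_beta
    by (intro continuous_intros continuous_on_compose2[OF phi_cont]) auto
  ultimately have "continuous_on ({0..R} \<times> {0..1}) (\<lambda>x. suminf (\<lambda>i. (\<lambda>(L,u). (-L) ^ i * phi i u) x))"
    by (intro uniform_limit_theorem[where F=sequentially]) auto
  then show ?thesis by (simp add: Phi_def case_prod_beta)
qed

lemma Phi_W_deriv:
  assumes "0 \<le> L" "u \<in> {0..1}"
  shows "(Phi L has_real_derivative poly r u * W L u) (at u within {0..1})"
    and "(W L has_real_derivative - L * Phi L u) (at u within {0..1})"
    and "Phi L 0 = 1" and "W L 0 = 0"
proof -
  have L: "L \<in> {-(L+1)..L+1}" using assms by auto
  obtain B where B: "summable B"
    "\<And>k u. u \<in> {0..1} \<Longrightarrow> norm ((-L) ^ k * phi k u) \<le> B k"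
    "\<And>k u. u \<in> {0..1} \<Longrightarrow> norm ((-L) ^ Suc k * phi k u) \<le> B k"
    "\<And>k u. u \<in> {0..1} \<Longrightarrow> norm ((-L) ^ Suc k * psi k u) \<le> B k"
    "\<And>k u. u \<in> {0..1} \<Longrightarrow> norm ((-L) ^ Suc k * (poly r u * psi k u)) \<le> B k"
    using term_bounds[of "L+1"] assms L by (metis add_nonneg_pos zero_less_one)
  have sPhi: "summable (\<lambda>k. (-L) ^ k * phi k u)" if "u \<in> {0..1}" for u
    using B(1,2) that by (meson summable_comparison_test')
  have sW: "summable (\<lambda>k. (-L) ^ Suc k * psi k u)" if "u \<in> {0..1}" for u
    using B(1,4) that by (meson summable_comparison_test')
  have z: "psi k 0 = 0" "phi (Suc k) 0 = 0" for k by (auto simp: psi_def)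
  \<comment> \<open>The term \<open>phi 0 = 1\<close> is split off because the termwise derivative
    \<open>r * psi k\<close> belongs to \<open>phi (Suc k)\<close>.\<close>
  have split: "Phi L u = 1 + (\<Sum>k. (-L) ^ Suc k * phi (Suc k) u)" if "u \<in> {0..1}" for u
    using suminf_split_head[OF sPhi[OF that]] unfolding Phi_def by simp
  show "Phi L 0 = 1" using split[of 0] z by simp
  show "W L 0 = 0" unfolding W_def by (simp add: z)
  have "\<exists>g. \<forall>x\<in>{0..1}. (\<lambda>k. (-L) ^ Suc k * psi k x) sums g x \<and>
     (g has_field_derivative (\<Sum>k. (-L) ^ Suc k * phi k x)) (at x within {0..1})"
  proof (rule has_field_derivative_series)
    show "uniform_limit {0..1} (\<lambda>n x. \<Sum>i<n. (-L) ^ Suc i * phi i x) (\<lambda>x. \<Sum>k. (-L) ^ Suc k * phi k x) sequentially"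
      using B by (intro Weierstrass_m_test[where M=B]) auto
    show "summable (\<lambda>k. (-L) ^ Suc k * psi k 0)" using sW by simp
  qed (auto intro!: DERIV_cmult psi_deriv simp del: power_Suc)
  then obtain g where g: "\<And>x. x \<in> {0..1} \<Longrightarrow> (\<lambda>k. (-L) ^ Suc k * psi k x) sums g x"
     "\<And>x. x \<in> {0..1} \<Longrightarrow> (g has_field_derivative (\<Sum>k. (-L) ^ Suc k * phi k x)) (at x within {0..1})"
    by blast
  have "g x = W L x" if "x \<in> {0..1}" for x using g(1)[OF that] unfolding W_def by (simp add: sums_iff)
  then have "(W L has_field_derivative (\<Sum>k. (-L) ^ Suc k * phi k u)) (at u within {0..1})"
    using g(2)[OF assms(2)] assms(2) by (intro has_field_derivative_transform_within[of g _ u "{0..1}" 1 "W L"]) auto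
  also have "(\<Sum>k. (-L) ^ Suc k * phi k u) = - L * Phi L u"
    unfolding Phi_def using suminf_mult[OF sPhi[OF assms(2)], of "-L"] by (simp add: mult_ac)
  finally show "(W L has_real_derivative - L * Phi L u) (at u within {0..1})" .
  have "\<exists>g. \<forall>x\<in>{0..1}. (\<lambda>k. (-L) ^ Suc k * phi (Suc k) x) sums g x \<and>
     (g has_field_derivative (\<Sum>k. (-L) ^ Suc k * (poly r x * psi k x))) (at x within {0..1})"
  proof (rule has_field_derivative_series)
    show "uniform_limit {0..1} (\<lambda>n x. \<Sum>i<n. (-L) ^ Suc i * (poly r x * psi i x)) (\<lambda>x. \<Sum>k. (-L) ^ Suc k * (poly r x * psi k x)) sequentially"
      using B by (intro Weierstrass_m_test[where M=B]) auto
    show "summable (\<lambda>k. (-L) ^ Suc k * phi (Suc k) 0)" using z by simp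
  qed (auto intro!: DERIV_cmult phi_Suc_deriv simp del: power_Suc phi.simps)
  then obtain g where g: "\<And>x. x \<in> {0..1} \<Longrightarrow> (\<lambda>k. (-L) ^ Suc k * phi (Suc k) x) sums g x"
     "\<And>x. x \<in> {0..1} \<Longrightarrow> (g has_field_derivative (\<Sum>k. (-L) ^ Suc k * (poly r x * psi k x))) (at x within {0..1})"
    by blast
  have "1 + g x = Phi L x" if "x \<in> {0..1}" for x
    using g(1)[OF that] split[OF that] by (simp add: sums_iff)
  moreover have "((\<lambda>x. 1 + g x) has_field_derivative (\<Sum>k. (-L) ^ Suc k * (poly r u * psi k u))) (at u within {0..1})"
    using g(2)[OF assms(2)] by (auto intro!: derivative_eq_intros simp del: power_Suc)
  ultimately have "(Phi L has_field_derivative (\<Sum>k. (-L) ^ Suc k * (poly r u * psi k u))) (at u within {0..1})"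
    using assms(2) by (intro has_field_derivative_transform_within[of "\<lambda>x. 1 + g x" _ u "{0..1}" 1 "Phi L"]) auto
  also have "(\<Sum>k. (-L) ^ Suc k * (poly r u * psi k u)) = poly r u * W L u"
    unfolding W_def using suminf_mult[OF sW[OF assms(2)], of "poly r u"] by (simp add: mult_ac)
  finally show "(Phi L has_real_derivative poly r u * W L u) (at u within {0..1})" .
qed

section \<open>Monotonicity of \<open>Phi\<close> in \<open>u\<close> and its first zero\<close>

lemma r_lower: obtains m where "\<And>u. u \<in> {0..1} \<Longrightarrow> m \<le> poly r u" and "0 < m"
proof -
  have "\<exists>x\<in>{0..1}. \<forall>y\<in>{0..1}. poly r x \<le> poly r y"
    by (intro continuous_attains_inf continuous_intros) auto
  then show ?thesis using that r_pos by blast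
qed

lemma Phi_cont: "0 \<le> L \<Longrightarrow> continuous_on {0..1} (Phi L)"
  using Phi_W_deriv(1) by (rule DERIV_continuous_on)

lemma W_cont: "0 \<le> L \<Longrightarrow> continuous_on {0..1} (W L)"
  using Phi_W_deriv(2) by (rule DERIV_continuous_on)

lemma W_antimono:
  assumes "0 \<le> L" "\<And>u. u \<in> {0..1} \<Longrightarrow> 0 \<le> Phi L u" "0 \<le> a" "a \<le> b" "b \<le> 1"
  shows "W L b \<le> W L a"
proof (cases "a = b")
  case False
  then obtain x where "a < x" "x < b" "W L b - W L a = (b - a) * (- L * Phi L x)"
    using mvt_unit_interval[OF Phi_W_deriv(2)[OF assms(1)], of a b] assms by (metis order_less_le)
  moreover have "(b - a) * (L * Phi L x) \<ge> 0" using assms calculation by (intro mult_nonneg_nonneg) auto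
  ultimately show ?thesis by simp
qed simp

text \<open>The slope of \<open>W\<close> at 0 is \<open>- L\<close>, so \<open>W\<close> is
  negative just to the right of 0; from there on it does not increase.\<close>

lemma W_neg:
  assumes "0 < L" "\<And>u. u \<in> {0..1} \<Longrightarrow> 0 \<le> Phi L u" "0 < u" "u \<le> 1"
  shows "W L u < 0"
proof -
  have "(W L has_real_derivative - L * Phi L 0) (at 0 within {0..1})" "- L * Phi L 0 < 0"
    using Phi_W_deriv[of L 0] assms by auto
  from has_real_derivative_neg_dec_right[OF this] obtain d where d: "0 < d"
    "\<And>h. 0 < h \<Longrightarrow> h \<in> {0..1} \<Longrightarrow> h < d \<Longrightarrow> W L h < 0"
    using Phi_W_deriv(4)[of L 0] assms by auto
  define h where "h = min u (d / 2)"
  have "0 < h" "h < d" "h \<le> u" using d assms unfolding h_def by auto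
  then have "W L u \<le> W L h" "W L h < 0" using assms d by (auto intro!: W_antimono)
  then show ?thesis by simp
qed

text \<open>\<open>Phi' = r * W\<close>, and \<open>W\<close> is negative to the right of 0.\<close>

lemma Phi_strict_antimono:
  assumes "0 < L" "\<And>u. u \<in> {0..1} \<Longrightarrow> 0 \<le> Phi L u" "0 \<le> a" "a < b" "b \<le> 1"
  shows "Phi L b < Phi L a"
proof -
  obtain x where x: "a < x" "x < b" "Phi L b - Phi L a = (b - a) * (poly r x * W L x)"
    using mvt_unit_interval[OF Phi_W_deriv(1), of L a b] assms by (metis order_less_imp_le)
  have "(b - a) * (poly r x * W L x) < 0"
    using x assms r_pos[of x] W_neg[OF assms(1,2)] by (intro mult_pos_neg) auto
  then show ?thesis using x by simp
qed

text \<open>If \<open>Phi R\<close> were positive throughout, it would decrease, so \<open>W\<close>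
  would be at most \<open>- R * Phi R (1/2) / 2\<close> on the right half of the interval. There
  \<open>Phi R\<close> would lose at least \<open>m * R / 4\<close> times its value at
  \<open>1/2\<close>.\<close>

lemma Phi_has_zero: obtains R u where "0 < R" "u \<in> {0..1}" "Phi R u \<le> 0"
proof -
  obtain m where m: "\<And>u. u \<in> {0..1} \<Longrightarrow> m \<le> poly r u" "0 < m" using r_lower by blast
  \<comment> \<open>With \<open>m * R / 4 = 1\<close> the loss on \<open>[1/2, 1]\<close> is the
    whole value at \<open>1/2\<close>.\<close>
  define R where "R = 4 / m"
  have R: "0 < R" using m by (simp add: R_def)
  have "\<exists>u\<in>{0..1}. Phi R u \<le> 0"
  proof (rule ccontr)
    assume "\<not> (\<exists>u\<in>{0..1}. Phi R u \<le> 0)"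
    then have pos: "\<And>u. u \<in> {0..1} \<Longrightarrow> 0 < Phi R u" by force
    then have nn: "\<And>u. u \<in> {0..1} \<Longrightarrow> 0 \<le> Phi R u" by force
    obtain x where x: "0 < x" "x < 1/2" "W R (1/2) - W R 0 = (1/2 - 0) * (- R * Phi R x)"
      using mvt_unit_interval[OF Phi_W_deriv(2), of R 0 "1/2"] R by auto
    have "Phi R (1/2) < Phi R x" using Phi_strict_antimono[OF R nn] x by auto
    then have "R * Phi R (1/2) \<le> R * Phi R x" using R by simp
    then have 1: "W R (1/2) \<le> - (R * Phi R (1/2)) / 2"
      using x Phi_W_deriv(4)[of R 0] R by simp
    obtain y where y: "1/2 < y" "y < 1" "Phi R 1 - Phi R (1/2) = (1 - 1/2) * (poly r y * W R y)"
      using mvt_unit_interval[OF Phi_W_deriv(1), of R "1/2" 1] R by auto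
    have "W R y \<le> W R (1/2)" using R nn y by (intro W_antimono) auto
    also note 1
    finally have 2: "R * Phi R (1/2) / 2 \<le> - W R y" by simp
    have "m * (R * Phi R (1/2) / 2) \<le> poly r y * (- W R y)"
      using 2 m y pos[of "1/2"] R r_pos[of y] by (intro mult_mono) auto
    moreover have "m * (R * Phi R (1/2) / 2) = 2 * Phi R (1/2)" using m by (simp add: R_def)
    moreover have "poly r y * W R y = 2 * (Phi R 1 - Phi R (1/2))" using y(3) by simp
    ultimately have "2 * Phi R (1/2) \<le> - (2 * (Phi R 1 - Phi R (1/2)))"
      unfolding mult_minus_right by (metis order.trans order.refl)
    then have "Phi R 1 \<le> 0" by simp
    then show False using pos[of 1] by simp
  qed
  then show ?thesis using that R by blast
qed

text \<open>\<open>\<Lambda>\<close> is the least \<open>L\<close> for which a nonpositive value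
  occurs. Letting \<open>L\<close> increase to \<open>\<Lambda>\<close> gives
  \<open>Phi \<Lambda> \<ge> 0\<close>, and strict monotonicity in \<open>u\<close> then leaves
  \<open>u = 1\<close> as the only place for a zero.\<close>

lemma principal_eigenvalue:
  obtains \<Lambda> where "0 < \<Lambda>"
    "\<And>L u. 0 \<le> L \<Longrightarrow> L < \<Lambda> \<Longrightarrow> u \<in> {0..1} \<Longrightarrow> 0 < Phi L u"
    "\<And>u. u \<in> {0..<1} \<Longrightarrow> 0 < Phi \<Lambda> u" "Phi \<Lambda> 1 = 0"
proof -
  obtain R u where R: "0 < R" "u \<in> {0..1}" "Phi R u \<le> 0" by (rule Phi_has_zero)
  define K where "K = ({0..R} \<times> {0..1}) \<inter> (\<lambda>(L, u). Phi L u) -` {..0}"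
  have "closed K" unfolding K_def
    by (intro continuous_closed_preimage Phi_continuous R closed_Times) auto
  then have "compact K"
    unfolding K_def by (metis Int_lower1 closed_Int_compact compact_Icc compact_Times inf.absorb1)
  moreover have "(R, u) \<in> K" using R by (auto simp: K_def)
  ultimately have "\<exists>p\<in>K. \<forall>q\<in>K. fst p \<le> fst q"
    by (intro continuous_attains_inf continuous_intros) auto
  then obtain \<Lambda> v where p: "(\<Lambda>, v) \<in> K" "\<And>L u. (L, u) \<in> K \<Longrightarrow> \<Lambda> \<le> L" by fastforce
  then have \<Lambda>: "0 \<le> \<Lambda>" "\<Lambda> \<le> R" "v \<in> {0..1}" "Phi \<Lambda> v \<le> 0" by (auto simp: K_def)
  have below: "0 < Phi L u" if "0 \<le> L" "L < \<Lambda>" "u \<in> {0..1}" for L u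
    using p(2)[of L u] that \<Lambda> by (force simp: K_def)
  \<comment> \<open>At \<open>L = 0\<close> only the first term of the series remains, which rules
    out \<open>\<Lambda> = 0\<close>.\<close>
  have "Phi 0 v = 1" unfolding Phi_def using suminf_finite[of "{0}" "\<lambda>k. (- 0) ^ k * phi k v"]
    by (simp add: power_0_left)
  then have pos: "0 < \<Lambda>" using \<Lambda> by (cases "\<Lambda> = 0") auto
  have nn: "0 \<le> Phi \<Lambda> u" if "u \<in> {0..1}" for u
  proof (rule continuous_ge_on_closure[of "{0..<\<Lambda>}" "\<lambda>L. Phi L u"])
    have "continuous_on {0..\<Lambda>} (\<lambda>L. (\<lambda>(L,u). Phi L u) (L, u))"
      using that \<Lambda> by (intro continuous_on_compose2[OF Phi_continuous[OF R(1)]] continuous_intros) auto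
    then show "continuous_on (closure {0..<\<Lambda>}) (\<lambda>L. Phi L u)" using pos by simp
    show "\<Lambda> \<in> closure {0..<\<Lambda>}" using pos by simp
    show "\<And>x. x \<in> {0..<\<Lambda>} \<Longrightarrow> 0 \<le> Phi x u" using below that by (force intro: less_imp_le)
  qed
  note dec = Phi_strict_antimono[OF pos nn]
  have "v = 1" using dec[of v 1] nn[of 1] \<Lambda> by force
  then have one: "Phi \<Lambda> 1 = 0" using nn[of 1] \<Lambda> by simp
  show ?thesis
    by (rule that[OF pos below _ one]) (use dec[of _ 1] one in auto)
qed

section \<open>The Rayleigh quotient and its infimum\<close>

lemma smooth_Phi:
  assumes "0 \<le> L"
  shows "smooth_01 (\<lambda>u. c * Phi L u)"
proof -
  \<comment> \<open>By \<open>Phi' = r * W\<close> and \<open>W' = - L * Phi\<close>, every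
    derivative has the form \<open>p * Phi + q * W\<close> with polynomials \<open>p\<close> and
    \<open>q\<close>; \<open>pq\<close> is the recursion for this pair.\<close>
  define pq where "pq = rec_nat ([:c:], 0) (\<lambda>_ (p, q). (pderiv p - smult L q, pderiv q + p * r))"
  have pq: "pq 0 = ([:c:], 0)"
    "pq (Suc n) = (pderiv (fst (pq n)) - smult L (snd (pq n)), pderiv (snd (pq n)) + fst (pq n) * r)" for n
    by (auto simp: pq_def case_prod_beta)
  define D where "D n u = poly (fst (pq n)) u * Phi L u + poly (snd (pq n)) u * W L u" for n u
  have "D 0 = (\<lambda>u. c * Phi L u)" by (auto simp: D_def pq)
  moreover have "(D n has_real_derivative D (Suc n) x) (at x within {0..1})" if "x \<in> {0..1}" for n x
    unfolding D_def
    by (rule derivative_eq_intros has_field_derivative_at_within[OF poly_DERIV]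
        Phi_W_deriv(1,2)[OF assms that] refl)+
      (simp add: pq algebra_simps)
  ultimately show ?thesis unfolding smooth_01_def by blast
qed

text \<open>This is \<open>jacobi_identity\<close> for \<open>Phi L\<close>, integrated. The
  boundary terms vanish because \<open>W L 0 = 0\<close> and \<open>\<psi> 1 = 0\<close>, and the
  integral of the weighted square is nonnegative.\<close>

lemma rayleigh_lower_bound:
  assumes L: "0 \<le> L" and pos: "\<And>u. u \<in> {0..1} \<Longrightarrow> 0 < Phi L u"
    and \<psi>: "\<And>u. u \<in> {0..1} \<Longrightarrow> (\<psi> has_real_derivative \<psi>' u) (at u within {0..1})"
    and cont: "continuous_on {0..1} \<psi>'" and "\<psi> 1 = 0"
  shows "L * integral {0..1} (\<lambda>u. (\<psi> u)\<^sup>2) \<le> integral {0..1} (\<lambda>u. 1 / poly r u * (\<psi>' u)\<^sup>2)"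
proof -
  define F where "F u = (\<psi> u)\<^sup>2 * W L u / Phi L u" for u
  define f where "f u = 1 / poly r u * (\<psi>' u)\<^sup>2 - L * (\<psi> u)\<^sup>2
      - 1 / poly r u * (\<psi>' u - poly r u * \<psi> u * W L u / Phi L u)\<^sup>2" for u
  have "(f has_integral F 1 - F 0) {0..1}"
  proof (rule fundamental_theorem_of_calculus)
    fix x :: real assume x: "x \<in> {0..1}"
    have nz: "Phi L x \<noteq> 0" "poly r x \<noteq> 0" using pos[OF x] r_pos[OF x] by auto
    have "(F has_real_derivative f x) (at x within {0..1})"
    proof -
      have "((\<lambda>u. (\<psi> u)\<^sup>2) has_real_derivative 2 * \<psi> x * \<psi>' x) (at x within {0..1})"
        using DERIV_power[OF \<psi>[OF x], of 2] by (simp add: mult_ac)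
      note D = DERIV_divide[OF DERIV_mult[OF this Phi_W_deriv(2)[OF L x]] Phi_W_deriv(1)[OF L x] nz(1)]
      show ?thesis unfolding F_def f_def jacobi_identity[OF nz]
        by (rule DERIV_cong[OF D]) (simp add: mult_ac)
    qed
    then show "(F has_vector_derivative f x) (at x within {0..1})"
      by (simp add: has_real_derivative_iff_has_vector_derivative)
  qed simp
  then have "(f has_integral 0) {0..1}"
    using assms(5) Phi_W_deriv(4)[of L 0] L by (simp add: F_def)
  moreover have c\<psi>: "continuous_on {0..1} \<psi>" using \<psi> by (rule DERIV_continuous_on)
  have r: "\<forall>x\<in>{0..1}. poly r x \<noteq> 0" using r_pos by force
  have "((\<lambda>u. 1 / poly r u * (\<psi>' u)\<^sup>2) has_integral integral {0..1} (\<lambda>u. 1 / poly r u * (\<psi>' u)\<^sup>2)) {0..1}"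
    using cont r by (intro integrable_integral integrable_continuous_real continuous_intros) auto
  moreover have "((\<lambda>u. L * (\<psi> u)\<^sup>2) has_integral L * integral {0..1} (\<lambda>u. (\<psi> u)\<^sup>2)) {0..1}"
    using c\<psi> by (intro has_integral_mult_right integrable_integral integrable_continuous_real continuous_intros)
  ultimately have "((\<lambda>u. 1 / poly r u * (\<psi>' u)\<^sup>2 - L * (\<psi> u)\<^sup>2 - f u) has_integral
     integral {0..1} (\<lambda>u. 1 / poly r u * (\<psi>' u)\<^sup>2) - L * integral {0..1} (\<lambda>u. (\<psi> u)\<^sup>2) - 0) {0..1}"
    by (intro has_integral_diff)
  then have "0 \<le> integral {0..1} (\<lambda>u. 1 / poly r u * (\<psi>' u)\<^sup>2) - L * integral {0..1} (\<lambda>u. (\<psi> u)\<^sup>2) - 0"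
    by (rule has_integral_nonneg) (use r_pos in \<open>force simp: f_def intro: less_imp_le\<close>)
  then show ?thesis by simp
qed

text \<open>The equation is multiplied by \<open>Phi L\<close> and integrated by parts;
  \<open>W L\<close> vanishes at 0 and \<open>Phi L\<close> at 1.\<close>

lemma eigenfunction_energy:
  assumes L: "0 \<le> L" and "Phi L 1 = 0"
  shows "integral {0..1} (\<lambda>u. 1 / poly r u * (poly r u * W L u)\<^sup>2) = L * integral {0..1} (\<lambda>u. (Phi L u)\<^sup>2)"
proof -
  define f where "f u = 1 / poly r u * (poly r u * W L u)\<^sup>2 - L * (Phi L u)\<^sup>2" for u
  have "(f has_integral W L 1 * Phi L 1 - W L 0 * Phi L 0) {0..1}"
  proof (rule fundamental_theorem_of_calculus)
    fix x :: real assume x: "x \<in> {0..1}"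
    have "((\<lambda>u. W L u * Phi L u) has_real_derivative f x) (at x within {0..1})"
      unfolding f_def
      by (rule derivative_eq_intros Phi_W_deriv(1,2)[OF L x] refl)+
        (use r_pos[OF x] in \<open>simp add: algebra_simps power2_eq_square\<close>)
    then show "((\<lambda>u. W L u * Phi L u) has_vector_derivative f x) (at x within {0..1})"
      by (simp add: has_real_derivative_iff_has_vector_derivative)
  qed simp
  then have 0: "(f has_integral 0) {0..1}"
    using assms(2) Phi_W_deriv(4)[of L 0] L by simp
  have 2: "((\<lambda>u. L * (Phi L u)\<^sup>2) has_integral L * integral {0..1} (\<lambda>u. (Phi L u)\<^sup>2)) {0..1}"
    using Phi_cont[OF L] by (intro has_integral_mult_right integrable_integral integrable_continuous_real continuous_intros)
  have "((\<lambda>u. f u + L * (Phi L u)\<^sup>2) has_integral 0 + L * integral {0..1} (\<lambda>u. (Phi L u)\<^sup>2)) {0..1}"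
    using 0 2 by (rule has_integral_add)
  then show ?thesis by (simp add: f_def integral_unique)
qed

lemma Lambda_infty_eq:
  assumes \<Lambda>: "0 < \<Lambda>"
    "\<And>L u. 0 \<le> L \<Longrightarrow> L < \<Lambda> \<Longrightarrow> u \<in> {0..1} \<Longrightarrow> 0 < Phi L u"
    "\<And>u. u \<in> {0..<1} \<Longrightarrow> 0 < Phi \<Lambda> u" "Phi \<Lambda> 1 = 0"
  shows "Lambda_infty (\<lambda>u. 1 / poly r u) = \<Lambda>"
proof -
  define E where "E \<phi> = (\<integral>v. 1 / poly r v * (deriv_01 \<phi> v)\<^sup>2 \<partial>lebesgue_on {0..1})" for \<phi>
  have r: "\<forall>x\<in>{0..1}. poly r x \<noteq> 0" using r_pos by force
  have norm: "(L2_norm_on {0<..<1} f)\<^sup>2 = integral {0..1} (\<lambda>u. (f u)\<^sup>2)" if "continuous_on {0..1} f" for f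
  proof -
    have "(\<integral>x. (f x)\<^sup>2 \<partial>lebesgue_on {0<..<1}) = integral {0..1} (\<lambda>u. (f u)\<^sup>2)"
      using that by (intro lebesgue_on_eq_integral continuous_intros)
    moreover have "0 \<le> (\<integral>x. (f x)\<^sup>2 \<partial>lebesgue_on {0<..<1})" by simp
    ultimately show ?thesis unfolding L2_norm_on_def by simp
  qed
  have en: "E f = integral {0..1} (\<lambda>u. 1 / poly r u * (f' u)\<^sup>2)"
    if "\<And>u. u \<in> {0..1} \<Longrightarrow> (f has_real_derivative f' u) (at u within {0..1})" "continuous_on {0..1} f'" for f f'
  proof -
    have "E f = (\<integral>u. 1 / poly r u * (f' u)\<^sup>2 \<partial>lebesgue_on {0..1})"
      unfolding E_def by (rule Bochner_Integration.integral_cong) (auto simp: deriv_01_eq[OF that(1)])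
    also have "\<dots> = integral {0..1} (\<lambda>u. 1 / poly r u * (f' u)\<^sup>2)"
      using that r by (intro lebesgue_on_eq_integral continuous_intros) auto
    finally show ?thesis .
  qed
  have lower: "\<Lambda> \<le> E f" if f: "f \<in> test_functions" for f
  proof (rule dense_le_bounded[OF \<Lambda>(1)])
    \<comment> \<open>\<open>Phi \<Lambda>\<close> vanishes at 1 and cannot serve as the divisor in
      Jacobi's identity. Each \<open>Phi L\<close> with \<open>L < \<Lambda>\<close> can, being
      positive on the closed interval.\<close>
    fix L assume L: "0 < L" "L < \<Lambda>"
    obtain D where D: "D 0 = f"
      "\<And>n x. x \<in> {0..1} \<Longrightarrow> (D n has_real_derivative D (Suc n) x) (at x within {0..1})"
      using f unfolding test_functions_def smooth_01_def by auto
    have d: "\<And>u. u \<in> {0..1} \<Longrightarrow> (f has_real_derivative D 1 u) (at u within {0..1})"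
      using D(2)[of _ 0] D(1) by simp
    have c: "continuous_on {0..1} (D 1)" "continuous_on {0..1} f"
      using D(2)[of _ 1] d by (blast intro: DERIV_continuous_on)+
    have "L * integral {0..1} (\<lambda>u. (f u)\<^sup>2) \<le> integral {0..1} (\<lambda>u. 1 / poly r u * (D 1 u)\<^sup>2)"
      using f L by (intro rayleigh_lower_bound d c \<Lambda>(2)) (auto simp: test_functions_def)
    then show "L \<le> E f"
      using norm[OF c(2)] en[OF d c(1)] f by (simp add: test_functions_def)
  qed
  have L0: "0 \<le> \<Lambda>" using \<Lambda> by simp
  define N where "N = L2_norm_on {0<..<1} (Phi \<Lambda>)"
  have N2: "N\<^sup>2 = integral {0..1} (\<lambda>u. (Phi \<Lambda> u)\<^sup>2)"
    unfolding N_def by (rule norm[OF Phi_cont[OF L0]])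
  have "N\<^sup>2 \<noteq> 0"
  proof
    assume "N\<^sup>2 = 0"
    then have "\<forall>x\<in>{0..1}. (Phi \<Lambda> x)\<^sup>2 = 0"
      using N2 integral_eq_0_iff[of 0 1 "\<lambda>x. (Phi \<Lambda> x)\<^sup>2"] continuous_on_power[OF Phi_cont[OF L0]] by simp
    then show False using \<Lambda>(3)[of 0] by auto
  qed
  then have N: "N \<noteq> 0" by simp
  have Npos: "0 < N" using N unfolding N_def L2_norm_on_def by (simp add: order_less_le)
  \<comment> \<open>The normalised eigenfunction is itself a test function, so the infimum is
    attained.\<close>
  define e where "e u = 1 / N * Phi \<Lambda> u" for u
  have de: "(e has_real_derivative 1 / N * (poly r u * W \<Lambda> u)) (at u within {0..1})" if "u \<in> {0..1}" for u
    unfolding e_def by (intro DERIV_cmult Phi_W_deriv L0 that)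
  have "L2_norm_on {0<..<1} e = 1 / N * N"
    using Npos unfolding e_def N_def L2_norm_on_def
    by (simp add: power_mult_distrib real_sqrt_mult power_divide real_sqrt_divide)
  then have e: "e \<in> test_functions"
    using N \<Lambda>(4) smooth_Phi[OF L0, of "1 / N"] deriv_01_eq[OF de, of 0] Phi_W_deriv(4)[OF L0, of 0]
    by (simp add: test_functions_def e_def[abs_def])
  have "E e = integral {0..1} (\<lambda>u. 1 / poly r u * (1 / N * (poly r u * W \<Lambda> u))\<^sup>2)"
    by (intro en de continuous_intros W_cont L0)
  also have "\<dots> = integral {0..1} (\<lambda>u. 1 / N\<^sup>2 * (1 / poly r u * (poly r u * W \<Lambda> u)\<^sup>2))"
    by (simp add: power_mult_distrib power_divide mult_ac)
  also have "\<dots> = 1 / N\<^sup>2 * integral {0..1} (\<lambda>u. 1 / poly r u * (poly r u * W \<Lambda> u)\<^sup>2)"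
    by (rule integral_mult_right)
  also have "\<dots> = \<Lambda>" using eigenfunction_energy[OF L0 \<Lambda>(4)] N unfolding N2[symmetric] by simp
  finally have Ee: "E e = \<Lambda>" .
  have "(INF \<phi>\<in>test_functions. E \<phi>) = \<Lambda>"
  proof (rule antisym)
    have "bdd_below (E ` test_functions)" using lower by (auto simp: bdd_below_def)
    then show "(INF \<phi>\<in>test_functions. E \<phi>) \<le> \<Lambda>"
      using cINF_lower[of E test_functions e] e Ee by simp
    show "\<Lambda> \<le> (INF \<phi>\<in>test_functions. E \<phi>)" using e lower by (intro cINF_greatest) auto
  qed
  then show ?thesis unfolding Lambda_infty_def E_def .
qed

end

subsection \<open>The comparison principle\<close>

text \<open>\<open>\<alpha>\<close> is the ellipticity constant and \<open>\<beta>\<close> bounds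
  the coefficient of the first-order term in \<open>(A V')' = A V'' + A' V'\<close>.\<close>

locale diffusivity =
  fixes A A' :: "real \<Rightarrow> real" and \<alpha> \<beta> :: real
  assumes A_deriv: "0 < u \<Longrightarrow> u < 1 \<Longrightarrow> (A has_real_derivative A' u) (at u)"
    and A_cont: "continuous_on {0..1} A"
    and A_ge: "0 \<le> u \<Longrightarrow> u \<le> 1 \<Longrightarrow> \<alpha> \<le> A u"
    and A'_le: "0 \<le> u \<Longrightarrow> u \<le> 1 \<Longrightarrow> \<bar>A' u\<bar> \<le> \<beta>"
    and \<alpha>_pos: "0 < \<alpha>"
begin

text \<open>At a negative interior minimum of the perturbed function, minimality in \<open>u\<close>
  gives \<open>X \<ge> - \<beta> * \<eta>\<close> and minimality in \<open>z\<close> gives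
  \<open>Vz \<le> - (\<beta> + 1) * \<eta>\<close>, against \<open>X \<le> Vz\<close>. The
  second-order condition is read off the flux \<open>A * Vu\<close>, so that no second derivative of
  \<open>V\<close> appears.\<close>

lemma comparison:
  fixes V Vu Vz X :: "real \<Rightarrow> real \<Rightarrow> real"
  assumes pq: "0 \<le> p" "p < q" "q \<le> 1"
    and cont: "continuous_on ({z1..z2} \<times> {p..q}) (\<lambda>(z, u). V z u)"
    and Vu: "\<And>z u. z1 < z \<Longrightarrow> z \<le> z2 \<Longrightarrow> p < u \<Longrightarrow> u < q \<Longrightarrow> (V z has_real_derivative Vu z u) (at u)"
    and Vz: "\<And>z u. z1 < z \<Longrightarrow> z \<le> z2 \<Longrightarrow> p < u \<Longrightarrow> u < q \<Longrightarrow>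
      ((\<lambda>s. V s u) has_real_derivative Vz z u) (at z)"
    and X: "\<And>z u. z1 < z \<Longrightarrow> z \<le> z2 \<Longrightarrow> p < u \<Longrightarrow> u < q \<Longrightarrow>
      ((\<lambda>v. A v * Vu z v) has_real_derivative X z u) (at u)"
    and super: "\<And>z u. z1 < z \<Longrightarrow> z \<le> z2 \<Longrightarrow> p < u \<Longrightarrow> u < q \<Longrightarrow> X z u \<le> Vz z u"
    and initial: "\<And>u. p \<le> u \<Longrightarrow> u \<le> q \<Longrightarrow> 0 \<le> V z1 u"
    and right: "\<And>z. z1 < z \<Longrightarrow> z \<le> z2 \<Longrightarrow> 0 \<le> V z q"
    and left: "(\<forall>z\<in>{z1<..z2}. 0 \<le> V z p) \<or>
      (\<forall>z\<in>{z1<..z2}. \<exists>D\<le>0. (V z has_real_derivative D) (at p within {p..q}))"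
    and z: "z1 \<le> z" "z \<le> z2" and u: "p \<le> u" "u \<le> q"
  shows "0 \<le> V z u"
proof (rule ccontr)
  assume neg: "\<not> 0 \<le> V z u"
  \<comment> \<open>Adding \<open>\<eta> g\<close> makes the inequality strict and, as \<open>g\<close> decreases in \<open>u\<close>, excludes a
    minimum at a Neumann end, where the equation itself need not hold.\<close>
  define g where "g z u = (\<beta> + 1) * (z - z1) + (2 - u)" for z u :: real
  have \<beta>: "0 \<le> \<beta>" using order_trans[OF abs_ge_zero A'_le[of 0]] by simp
  have g_pos: "0 < g z u" if "z1 \<le> z" "u \<le> q" for z u
    unfolding g_def using that \<beta> pq by (intro add_nonneg_pos mult_nonneg_nonneg) auto
  \<comment> \<open>With this \<open>\<eta>\<close> the perturbation halves the negative value: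
    \<open>U = V / 2\<close> at the given point, so \<open>U\<close> is still negative
    there.\<close>
  define \<eta> where "\<eta> = - V z u / (2 * g z u)"
  have \<eta>: "0 < \<eta>" unfolding \<eta>_def using neg g_pos z u by (intro divide_pos_pos) auto
  define U where "U z u = V z u + \<eta> * g z u" for z u
  have "U z u = V z u / 2" unfolding U_def \<eta>_def using g_pos[of z u] z u by (simp add: field_simps)
  then have U_neg: "U z u < 0" using neg by simp
  have "continuous_on ({z1..z2} \<times> {p..q}) (\<lambda>x. U (fst x) (snd x))"
    using cont unfolding U_def g_def case_prod_beta by (intro continuous_intros)
  moreover have "compact ({z1..z2} \<times> {p..q})" "({z1..z2} \<times> {p..q}) \<noteq> {}"
    using z u by (auto intro: compact_Times)
  ultimately have "\<exists>m\<in>{z1..z2} \<times> {p..q}. \<forall>x\<in>{z1..z2} \<times> {p..q}. U (fst m) (snd m) \<le> U (fst x) (snd x)"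
    by (intro continuous_attains_inf)
  then obtain m where m: "m \<in> {z1..z2} \<times> {p..q}"
    "\<And>x. x \<in> {z1..z2} \<times> {p..q} \<Longrightarrow> U (fst m) (snd m) \<le> U (fst x) (snd x)"
    by metis
  define s where "s = fst m" define v where "v = snd m"
  have sv: "z1 \<le> s" "s \<le> z2" "p \<le> v" "v \<le> q" using m(1) by (auto simp: s_def v_def)
  have min: "U s v \<le> U z u" if "z1 \<le> z" "z \<le> z2" "p \<le> u" "u \<le> q" for z u
    using m(2)[of "(z, u)"] that by (simp add: s_def v_def)
  have "U s v < 0" using min[OF z u] U_neg by simp
  then have V_neg: "V s v < 0" unfolding U_def using \<eta> g_pos[of s v] sv
    by (smt (verit) mult_pos_pos)
  have s: "z1 < s" using V_neg initial[of v] sv by (cases "s = z1") auto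
  have "v \<noteq> q" using V_neg right[of s] s sv by auto
  then have v: "v < q" using sv by simp
  show False
  proof (cases "v = p")
    case True
    then obtain D where D: "D \<le> 0" "(V s has_real_derivative D) (at p within {p..q})"
      using left V_neg s sv by (metis greaterThanAtMost_iff linorder_not_le)
    have "(U s has_real_derivative D - \<eta>) (at p within {p..q})"
      unfolding U_def g_def by (auto intro!: derivative_eq_intros D(2))
    from has_real_derivative_neg_dec_right[OF this] obtain d where d: "0 < d"
      "\<And>h. 0 < h \<Longrightarrow> p + h \<in> {p..q} \<Longrightarrow> h < d \<Longrightarrow> U s (p + h) < U s p"
      using D \<eta> by auto
    define h where "h = min (q - p) (d / 2)"
    have "0 < h" "p + h \<in> {p..q}" "h < d" using d pq by (auto simp: h_def)
    then show False using d(2)[of h] min[of s "p + h"] sv True by auto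
  next
    case False
    then have v: "p < v" "v < q" using v sv by auto
    have v1: "0 < v" "v < 1" using v pq by auto
    have Us: "(U s has_real_derivative Vu s x - \<eta>) (at x)" if "p < x" "x < q" for x
      unfolding U_def g_def using Vu[OF s sv(2) that] by (auto intro!: derivative_eq_intros)
    have 0: "Vu s v - \<eta> = 0"
    proof (rule DERIV_local_min[OF Us[OF v]])
      show "0 < min (v - p) (q - v)" using v by simp
      show "\<forall>y. \<bar>v - y\<bar> < min (v - p) (q - v) \<longrightarrow> U s v \<le> U s y"
        using min[of s] sv by (auto simp: abs_if split: if_splits)
    qed
    have Y: "((\<lambda>x. A x * (Vu s x - \<eta>)) has_real_derivative X s v - \<eta> * A' v) (at v)"
    proof -
      have "((\<lambda>x. A x * Vu s x - \<eta> * A x) has_real_derivative X s v - \<eta> * A' v) (at v)"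
        by (intro DERIV_diff DERIV_cmult X s sv v A_deriv v1)
      then show ?thesis by (simp add: algebra_simps)
    qed
    \<comment> \<open>The flux of \<open>U\<close> is zero at the minimum. Were its derivative
      negative, the flux would be negative just to the right of \<open>v\<close>, and
      \<open>U\<close> would fall below its minimum.\<close>
    have "0 \<le> X s v - \<eta> * A' v"
    proof (rule ccontr)
      assume "\<not> 0 \<le> X s v - \<eta> * A' v"
      then obtain d where d: "0 < d"
        "\<And>h. 0 < h \<Longrightarrow> h < d \<Longrightarrow> A (v + h) * (Vu s (v + h) - \<eta>) < 0"
        using DERIV_neg_dec_right[OF Y] 0 by auto
      define h where "h = min (q - v) d / 2"
      have h: "0 < h" "h < d" "v + h < q" using d v by (auto simp: h_def min_def field_simps)
      obtain x where x: "v < x" "x < v + h" "U s (v + h) - U s v = (v + h - v) * (Vu s x - \<eta>)"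
        using MVT2[of v "v + h" "U s" "\<lambda>x. Vu s x - \<eta>"] Us v h by force
      have "A x * (Vu s x - \<eta>) < 0" using d(2)[of "x - v"] x h by simp
      then have "Vu s x - \<eta> < 0" using A_ge[of x] \<alpha>_pos x h v pq
        by (smt (verit) mult_nonneg_nonneg)
      then have "(v + h - v) * (Vu s x - \<eta>) < 0" using h by (intro mult_pos_neg) auto
      then have "U s (v + h) < U s v" using x(3) by linarith
      then show False using min[of s "v + h"] sv h v by auto
    qed
    moreover have "- \<beta> * \<eta> \<le> \<eta> * A' v"
    proof -
      have "\<eta> * - \<beta> \<le> \<eta> * A' v" using A'_le[of v] v1 \<eta> by (intro mult_left_mono) auto
      then show ?thesis by (simp add: mult.commute)
    qed
    ultimately have lower: "- \<beta> * \<eta> \<le> X s v" by linarith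
    have Uz: "((\<lambda>z. U z v) has_real_derivative Vz s v + \<eta> * (\<beta> + 1)) (at s)"
      unfolding U_def g_def using Vz[OF s sv(2) v] by (auto intro!: derivative_eq_intros)
    \<comment> \<open>\<open>s\<close> may be the final time, so the comparison is with earlier
      times, and it makes the derivative nonpositive rather than zero.\<close>
    have "Vz s v + \<eta> * (\<beta> + 1) \<le> 0"
    proof (rule ccontr)
      assume "\<not> Vz s v + \<eta> * (\<beta> + 1) \<le> 0"
      then obtain d where d: "0 < d" "\<And>h. 0 < h \<Longrightarrow> h < d \<Longrightarrow> U (s - h) v < U s v"
        using DERIV_pos_inc_left[OF Uz] by auto
      define h where "h = min (s - z1) d / 2"
      have h: "0 < h" "h < d" "z1 \<le> s - h" using d s by (auto simp: h_def min_def field_simps)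
      then show False using d(2)[of h] min[of "s - h" v] sv by auto
    qed
    then show False using lower super[OF s sv(2) v] \<eta> by (simp add: algebra_simps)
  qed
qed

end

text \<open>\<open>neg_part\<close> is a \<open>C\<^sup>2\<close> convex substitute for \<open>(min y 0)\<^sup>2\<close>; it equals
  \<open>y\<^sup>4 / (1 + y\<^sup>2)\<close> for \<open>y \<le> 0\<close>.\<close>

definition neg_part :: "real \<Rightarrow> real" where
  "neg_part y = (if y \<le> 0 then y\<^sup>2 - 1 + 1 / (1 + y\<^sup>2) else 0)"

definition neg_part' :: "real \<Rightarrow> real" where
  "neg_part' y = (if y \<le> 0 then 2 * y - 2 * y / (1 + y\<^sup>2)\<^sup>2 else 0)"

definition neg_part'' :: "real \<Rightarrow> real" where
  "neg_part'' y = (if y \<le> 0 then 2 - 2 / (1 + y\<^sup>2)\<^sup>2 + 8 * y\<^sup>2 / (1 + y\<^sup>2) ^ 3 else 0)"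

lemma one_plus_square_neq_0 [simp]: "1 + (y::real)\<^sup>2 \<noteq> 0" "1 + (y::real) * y \<noteq> 0"
  by (smt (verit) zero_le_power2, smt (verit) zero_le_square)

lemma neg_part_deriv: "(neg_part has_real_derivative neg_part' y) (at y)"
  unfolding neg_part_def neg_part'_def
  by (rule DERIV_cut_nonpos) (auto intro!: derivative_eq_intros simp: power2_eq_square)

lemma neg_part'_deriv: "(neg_part' has_real_derivative neg_part'' y) (at y)"
  unfolding neg_part'_def neg_part''_def
proof (rule DERIV_cut_nonpos)
  fix y :: real
  have "((\<lambda>y. 2 * y - 2 * y / (1 + y\<^sup>2)\<^sup>2) has_real_derivative
     2 - (2 * (1 + y\<^sup>2)\<^sup>2 - 2 * y * (2 * (1 + y\<^sup>2) * (2 * y))) / ((1 + y\<^sup>2)\<^sup>2 * (1 + y\<^sup>2)\<^sup>2)) (at y)"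
    by (auto intro!: derivative_eq_intros)
  also have "2 - (2 * (1 + y\<^sup>2)\<^sup>2 - 2 * y * (2 * (1 + y\<^sup>2) * (2 * y))) / ((1 + y\<^sup>2)\<^sup>2 * (1 + y\<^sup>2)\<^sup>2)
     = 2 - 2 / (1 + y\<^sup>2)\<^sup>2 + 8 * y\<^sup>2 / (1 + y\<^sup>2) ^ 3"
  proof -
    have "(2 * c\<^sup>2 - 2 * y * (2 * c * (2 * y))) / (c\<^sup>2 * c\<^sup>2) = 2 / c\<^sup>2 - 8 * y\<^sup>2 / c ^ 3" if "c \<noteq> 0" for c :: real
      using that by (simp add: field_simps power2_eq_square power3_eq_cube)
    from this[OF one_plus_square_neq_0(1)] show ?thesis by simp
  qed
  finally show "((\<lambda>y. 2 * y - 2 * y / (1 + y\<^sup>2)\<^sup>2) has_real_derivative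
     2 - 2 / (1 + y\<^sup>2)\<^sup>2 + 8 * y\<^sup>2 / (1 + y\<^sup>2) ^ 3) (at y)" .
qed auto

text \<open>Convexity gives the dissipation term in the flux identity its sign.\<close>

lemma neg_part''_nonneg: "0 \<le> neg_part'' y"
proof -
  have "2 / (1 + y\<^sup>2)\<^sup>2 \<le> 2 / 1" by (rule divide_left_mono) (auto simp: one_le_power)
  moreover have "0 \<le> 8 * y\<^sup>2 / (1 + y\<^sup>2) ^ 3" by simp
  ultimately show ?thesis unfolding neg_part''_def by simp
qed

lemma neg_part_alt: "y \<le> 0 \<Longrightarrow> neg_part y = y\<^sup>2 * y\<^sup>2 / (1 + y\<^sup>2)"
  unfolding neg_part_def by (simp add: field_simps)

lemma neg_part_nonneg: "0 \<le> neg_part y"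
  by (cases "y \<le> 0") (simp add: neg_part_alt, simp add: neg_part_def)

lemma neg_part_le: "y \<le> 0 \<Longrightarrow> neg_part y \<le> y\<^sup>2"
  using divide_left_mono[of 1 "1 + y\<^sup>2" 1] by (simp add: neg_part_def add_pos_nonneg)

lemma neg_part_eq_0_imp: "neg_part y = 0 \<Longrightarrow> 0 \<le> y"
  by (cases "y \<le> 0") (auto simp: neg_part_alt)

lemma neg_part_of_nonneg [simp]: "0 \<le> y \<Longrightarrow> neg_part y = 0" "0 \<le> y \<Longrightarrow> neg_part' y = 0"
  by (auto simp: neg_part_def neg_part'_def)

lemma neg_part_cont: "continuous_on S neg_part" "continuous_on S neg_part'"
  using neg_part_deriv neg_part'_deriv
  by (meson DERIV_continuous_on has_field_derivative_at_within)+

subsection \<open>Positivity of solutions\<close>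

text \<open>\<open>diffusion_solution\<close> with its derivatives as parameters, joined with the
  conditions on the initial value. \<open>T_lim\<close> is the link between \<open>T\<close> at
  positive \<open>z\<close> and \<open>\<phi>\<close>.\<close>

locale diffusion = diffusivity +
  fixes \<phi> :: "real \<Rightarrow> real" and T Tu Tz :: "real \<Rightarrow> real \<Rightarrow> real"
  assumes T_cont: "continuous_on ({0<..} \<times> {0..1}) (\<lambda>(z, u). T z u)"
    and Tu_cont: "continuous_on ({0<..} \<times> {0..<1}) (\<lambda>(z, u). Tu z u)"
    and Tz_cont: "continuous_on ({0<..} \<times> {0<..<1}) (\<lambda>(z, u). Tz z u)"
    and Tu_within: "0 < z \<Longrightarrow> u \<in> {0..<1} \<Longrightarrow> (T z has_real_derivative Tu z u) (at u within {0..1})"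
    and Tz: "0 < z \<Longrightarrow> u \<in> {0<..<1} \<Longrightarrow> ((\<lambda>s. T s u) has_real_derivative Tz z u) (at z)"
    and ATu: "0 < z \<Longrightarrow> u \<in> {0<..<1} \<Longrightarrow> ((\<lambda>v. A v * Tu z v) has_real_derivative Tz z u) (at u)"
    and neumann: "0 < z \<Longrightarrow> Tu z 0 = 0"
    and dirichlet: "0 < z \<Longrightarrow> T z 1 = 0"
    and T_0: "AE u in lebesgue_on {0<..<1}. T 0 u = \<phi> u"
    and T_L2: "0 \<le> z \<Longrightarrow> T z \<in> L2_on {0<..<1}"
    and T_lim: "((\<lambda>z. L2_norm_on {0<..<1} (\<lambda>u. T z u - T 0 u)) \<longlongrightarrow> 0) (at 0 within {0..})"
    and \<phi>_nonneg: "AE u in lebesgue_on {0<..<1}. 0 \<le> \<phi> u"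
    and \<phi>_nonzero: "\<not> (AE u in lebesgue_on {0<..<1}. \<phi> u = 0)"
begin

lemma Tu_at: "0 < z \<Longrightarrow> 0 < u \<Longrightarrow> u < 1 \<Longrightarrow> (T z has_real_derivative Tu z u) (at u)"
  using Tu_within[of z u] by (simp add: at_within_Icc_at)

lemma T_cont_on: "0 < z1 \<Longrightarrow> continuous_on ({z1..z2} \<times> {0..1}) (\<lambda>x. T (fst x) (snd x))"
  using continuous_on_subset[OF T_cont, of "{z1..z2} \<times> {0..1}"] by (fastforce simp: case_prod_beta)

lemma T_cont_u: "0 < z \<Longrightarrow> continuous_on {0..1} (T z)"
  using continuous_on_compose2[OF T_cont_on[of z z], of "{0..1}" "\<lambda>u. (z, u)"]
  by (auto simp: continuous_on_Pair)

section \<open>Decay of the negative part of a solution\<close>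

definition excess :: "real \<Rightarrow> real \<Rightarrow> real" where
  "excess \<delta> z = integral {0..1} (\<lambda>u. neg_part (T z u + \<delta>))"

lemma neg_part_T_cont: "0 < z \<Longrightarrow> continuous_on {0..1} (\<lambda>u. neg_part (T z u + \<delta>))"
  using T_cont_u by (intro continuous_on_compose2[OF neg_part_cont(1)[of UNIV]] continuous_intros) auto

text \<open>Since \<open>T + \<delta> > 0\<close> near \<open>u = 1\<close>, no regularity of \<open>Tu\<close> is needed there; at \<open>u = 0\<close>, where
  \<open>Tz\<close> may be singular, the cut at \<open>\<kappa>\<close> costs only a small flux.\<close>

lemma excess_truncated:
  assumes z: "0 < z1" "z1 < z2" and \<delta>: "0 < \<delta>" and e: "0 < e"
  obtains b \<kappa>0 where "0 < \<kappa>0" "\<kappa>0 < b" "b < 1"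
    "\<And>z u. z1 \<le> z \<Longrightarrow> z \<le> z2 \<Longrightarrow> b \<le> u \<Longrightarrow> u \<le> 1 \<Longrightarrow> 0 < T z u + \<delta>"
    "\<And>\<kappa>. 0 < \<kappa> \<Longrightarrow> \<kappa> < \<kappa>0 \<Longrightarrow>
      integral {\<kappa>..b} (\<lambda>u. neg_part (T z2 u + \<delta>)) - integral {\<kappa>..b} (\<lambda>u. neg_part (T z1 u + \<delta>)) \<le> (z2 - z1) * e"
proof -
  have "uniformly_continuous_on ({z1..z2} \<times> {0..1}) (\<lambda>x. T (fst x) (snd x))"
    by (intro compact_uniformly_continuous T_cont_on z compact_Times) auto
  then obtain d where d: "0 < d" and dT: "\<And>x x'. x \<in> {z1..z2} \<times> {0..1} \<Longrightarrow> x' \<in> {z1..z2} \<times> {0..1} \<Longrightarrow>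
      dist x' x < d \<Longrightarrow> dist (T (fst x') (snd x')) (T (fst x) (snd x)) < \<delta>"
    using \<delta> unfolding uniformly_continuous_on_def by meson
  \<comment> \<open>Points with \<open>u \<ge> b\<close> are closer than \<open>d\<close> to the
    Dirichlet end, so \<open>T\<close> differs there from its boundary value 0 by less than
    \<open>\<delta>\<close>.\<close>
  define b where "b = max (1/2) (1 - d/2)"
  have b: "0 < b" "b < 1" using d by (auto simp: b_def)
  have T_gt: "0 < T z u + \<delta>" if "z1 \<le> z" "z \<le> z2" "b \<le> u" "u \<le> 1" for z u
  proof -
    have "dist (z, u) (z, 1) < d" using that d by (auto simp: dist_Pair_Pair dist_real_def b_def)
    then have "dist (T z u) (T z 1) < \<delta>" using dT[of "(z, 1)" "(z, u)"] that b by auto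
    then show ?thesis using dirichlet[of z] that z by (auto simp: dist_real_def)
  qed
  \<comment> \<open>The flux in the balance for \<open>neg_part (T + \<delta>)\<close>. It vanishes
    at \<open>b\<close>, where \<open>T + \<delta>\<close> is positive, and at 0 by the Neumann
    condition; uniform continuity makes it smaller than \<open>e\<close> at
    \<open>\<kappa>\<close>.\<close>
  define F where "F z u = neg_part' (T z u + \<delta>) * (A u * Tu z u)" for z u
  have sub: "{z1..z2} \<times> {0..b} \<subseteq> {0<..} \<times> {0..<1}" using z b by auto
  have Tub: "continuous_on ({z1..z2} \<times> {0..b}) (\<lambda>x. Tu (fst x) (snd x))"
    using continuous_on_subset[OF Tu_cont sub] by (simp add: case_prod_beta)
  have Tb: "continuous_on ({z1..z2} \<times> {0..b}) (\<lambda>x. T (fst x) (snd x))"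
    using b by (intro continuous_on_subset[OF T_cont_on[OF z(1), of z2]]) auto
  have "continuous_on ({z1..z2} \<times> {0..b}) (\<lambda>x. F (fst x) (snd x))"
    unfolding F_def using b
    by (intro continuous_intros Tub continuous_on_compose2[OF neg_part_cont(2)[of UNIV]]
        continuous_on_compose2[OF A_cont] Tb) auto
  then have "uniformly_continuous_on ({z1..z2} \<times> {0..b}) (\<lambda>x. F (fst x) (snd x))"
    by (intro compact_uniformly_continuous compact_Times) auto
  then obtain d' where d': "0 < d'" and dF: "\<And>x x'. x \<in> {z1..z2} \<times> {0..b} \<Longrightarrow> x' \<in> {z1..z2} \<times> {0..b} \<Longrightarrow>
      dist x' x < d' \<Longrightarrow> dist (F (fst x') (snd x')) (F (fst x) (snd x)) < e"
    using e unfolding uniformly_continuous_on_def by meson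
  define \<kappa>0 where "\<kappa>0 = min (b / 2) d'"
  have \<kappa>0: "0 < \<kappa>0" "\<kappa>0 < b" using b d' by (auto simp: \<kappa>0_def)
  have main: "integral {\<kappa>..b} (\<lambda>u. neg_part (T z2 u + \<delta>)) - integral {\<kappa>..b} (\<lambda>u. neg_part (T z1 u + \<delta>)) \<le> (z2 - z1) * e"
    if \<kappa>: "0 < \<kappa>" "\<kappa> < \<kappa>0" for \<kappa>
  proof -
    have \<kappa>b: "\<kappa> < b" using \<kappa> \<kappa>0 by simp
    define h where "h z u = neg_part' (T z u + \<delta>) * Tz z u" for z u
    have sub: "{z1..z2} \<times> {\<kappa>..b} \<subseteq> {0<..} \<times> {0<..<1}" "{z1..z2} \<times> {\<kappa>..b} \<subseteq> {z1..z2} \<times> {0..b}"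
      using z b \<kappa> by auto
    have h_cont: "continuous_on ({z1..z2} \<times> {\<kappa>..b}) (\<lambda>(z, u). h z u)"
      unfolding h_def case_prod_beta
      using continuous_on_subset[OF Tz_cont sub(1)] continuous_on_subset[OF Tb sub(2)]
      by (intro continuous_intros continuous_on_compose2[OF neg_part_cont(2)[of UNIV]])
        (auto simp: case_prod_beta)
    have J: "((\<lambda>z. integral {\<kappa>..b} (\<lambda>u. neg_part (T z u + \<delta>))) has_real_derivative integral {\<kappa>..b} (h z))
        (at z within {z1..z2})" if "z \<in> {z1..z2}" for z
    proof -
      have "((\<lambda>z. integral (cbox \<kappa> b) (\<lambda>u. neg_part (T z u + \<delta>))) has_real_derivative integral (cbox \<kappa> b) (h z))
        (at z within {z1..z2})"
      proof (rule leibniz_rule_field_derivative)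
        fix z t assume "z \<in> {z1..z2}" "t \<in> cbox \<kappa> b"
        then have zt: "0 < z" "t \<in> {0<..<1}" using z b \<kappa> by auto
        have "((\<lambda>z. neg_part (T z t + \<delta>)) has_real_derivative neg_part' (T z t + \<delta>) * (Tz z t + 0)) (at z)"
          by (intro DERIV_chain2[OF neg_part_deriv] DERIV_add Tz zt DERIV_const)
        then show "((\<lambda>z. neg_part (T z t + \<delta>)) has_real_derivative h z t) (at z within {z1..z2})"
          unfolding h_def by (simp add: has_field_derivative_at_within)
      next
        fix z assume "z \<in> {z1..z2}"
        then show "(\<lambda>u. neg_part (T z u + \<delta>)) integrable_on cbox \<kappa> b"
          using z b \<kappa> unfolding cbox_interval
          by (intro integrable_continuous_real continuous_on_subset[OF neg_part_T_cont]) auto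
      qed (use h_cont that in auto)
      then show ?thesis by simp
    qed
    have J_le: "integral {\<kappa>..b} (h z) \<le> e" if "z \<in> {z1..z2}" for z
    proof -
      have z0: "0 < z" using that z by auto
      \<comment> \<open>The derivative of \<open>F z\<close> is a dissipation term, nonnegative by
        convexity, plus \<open>h z\<close>. Hence the integral of \<open>h z\<close> is at most the
        difference of the fluxes at the two ends.\<close>
      have flux: "((\<lambda>u. neg_part'' (T z u + \<delta>) * Tu z u * (A u * Tu z u) + h z u) has_integral F z b - F z \<kappa>) {\<kappa>..b}"
      proof (rule fundamental_theorem_of_calculus)
        fix u assume "u \<in> {\<kappa>..b}"
        then have u: "0 < u" "u < 1" using \<kappa> b by auto
        have "((\<lambda>u. neg_part' (T z u + \<delta>)) has_real_derivative neg_part'' (T z u + \<delta>) * (Tu z u + 0)) (at u)"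
          by (intro DERIV_chain2[OF neg_part'_deriv] DERIV_add Tu_at z0 u DERIV_const)
        then have "(F z has_real_derivative
            neg_part'' (T z u + \<delta>) * (Tu z u + 0) * (A u * Tu z u) + Tz z u * neg_part' (T z u + \<delta>)) (at u)"
          unfolding F_def using ATu[OF z0, of u] u by (intro DERIV_mult) auto
        then have "(F z has_real_derivative neg_part'' (T z u + \<delta>) * Tu z u * (A u * Tu z u) + h z u) (at u)"
          by (simp add: h_def mult.commute)
        then show "(F z has_vector_derivative neg_part'' (T z u + \<delta>) * Tu z u * (A u * Tu z u) + h z u)
            (at u within {\<kappa>..b})"
          by (simp add: has_real_derivative_iff_has_vector_derivative[symmetric] has_field_derivative_at_within)
      qed (use \<kappa>b in simp)
      have hI: "(h z has_integral integral {\<kappa>..b} (h z)) {\<kappa>..b}"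
      proof (intro integrable_integral integrable_continuous_real)
        have "continuous_on {\<kappa>..b} (\<lambda>u. (\<lambda>(z, u). h z u) (z, u))"
          using that by (intro continuous_on_compose2[OF h_cont] continuous_intros) auto
        then show "continuous_on {\<kappa>..b} (h z)" by simp
      qed
      have h_le: "h z u \<le> neg_part'' (T z u + \<delta>) * Tu z u * (A u * Tu z u) + h z u" if "u \<in> {\<kappa>..b}" for u
      proof -
        have "0 \<le> A u" using A_ge[of u] \<alpha>_pos that \<kappa> b by simp
        then have "0 \<le> neg_part'' (T z u + \<delta>) * A u * (Tu z u * Tu z u)"
          using neg_part''_nonneg by (intro mult_nonneg_nonneg zero_le_square) auto
        then show ?thesis by (simp add: mult_ac)
      qed
      have "integral {\<kappa>..b} (h z) \<le> F z b - F z \<kappa>" by (rule has_integral_le[OF hI flux h_le])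
      moreover have "F z b = 0" using T_gt[of z b] that b unfolding F_def by simp
      moreover have "\<bar>F z \<kappa>\<bar> < e"
      proof -
        have "dist (F z \<kappa>) (F z 0) < e"
          using dF[of "(z, 0)" "(z, \<kappa>)"] that \<kappa> \<kappa>b b by (auto simp: dist_Pair_Pair \<kappa>0_def)
        then show ?thesis using neumann[OF z0] by (simp add: F_def)
      qed
      ultimately show ?thesis by simp
    qed
    have "\<exists>x\<in>{z1<..<z2}. integral {\<kappa>..b} (\<lambda>u. neg_part (T z2 u + \<delta>)) - integral {\<kappa>..b} (\<lambda>u. neg_part (T z1 u + \<delta>))
        = integral {\<kappa>..b} (h x) * (z2 - z1)"
      using z J by (intro mvt_simple) (auto simp: has_field_derivative_def)
    then obtain x where "x \<in> {z1<..<z2}" and x: "integral {\<kappa>..b} (\<lambda>u. neg_part (T z2 u + \<delta>)) -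
        integral {\<kappa>..b} (\<lambda>u. neg_part (T z1 u + \<delta>)) = integral {\<kappa>..b} (h x) * (z2 - z1)" by blast
    then have "integral {\<kappa>..b} (h x) * (z2 - z1) \<le> e * (z2 - z1)" using J_le[of x] z by (intro mult_right_mono) auto
    then show ?thesis using x by (simp add: mult.commute)
  qed
  show ?thesis by (rule that[OF \<kappa>0 b(2) T_gt main])
qed

text \<open>The unit interval is cut at \<open>\<kappa>\<close> and \<open>b\<close>. The integrand
  is zero on \<open>[b, 1]\<close>, \<open>excess_truncated\<close> bounds the growth on
  \<open>[\<kappa>, b]\<close>, and \<open>[0, \<kappa>]\<close> contributes at most
  \<open>K * \<kappa>\<close> at time \<open>z2\<close>.\<close>

lemma excess_antimono:
  assumes z: "0 < z1" "z1 < z2" and \<delta>: "0 < \<delta>"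
  shows "excess \<delta> z2 \<le> excess \<delta> z1"
proof (rule field_le_epsilon)
  fix e :: real assume e: "0 < e"
  \<comment> \<open>One half of \<open>e\<close> pays for the flux through the cut, the other half
    for \<open>K * \<kappa>\<close>.\<close>
  define e1 where "e1 = e / (2 * (z2 - z1))"
  have e1: "0 < e1" "(z2 - z1) * e1 = e / 2"
    using e z by (simp_all add: e1_def divide_simps)
  obtain b \<kappa>0 where \<kappa>0: "0 < \<kappa>0" "\<kappa>0 < b" "b < 1"
    and pos: "\<And>z u. z1 \<le> z \<Longrightarrow> z \<le> z2 \<Longrightarrow> b \<le> u \<Longrightarrow> u \<le> 1 \<Longrightarrow> 0 < T z u + \<delta>"
    and le: "\<And>\<kappa>. 0 < \<kappa> \<Longrightarrow> \<kappa> < \<kappa>0 \<Longrightarrow>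
      integral {\<kappa>..b} (\<lambda>u. neg_part (T z2 u + \<delta>)) - integral {\<kappa>..b} (\<lambda>u. neg_part (T z1 u + \<delta>)) \<le> (z2 - z1) * e1"
    using excess_truncated[OF z \<delta> e1(1)] by metis
  have "compact ((\<lambda>u. neg_part (T z2 u + \<delta>)) ` {0..1})"
    using z by (intro compact_continuous_image neg_part_T_cont) auto
  from compact_imp_bounded[OF this] obtain K where K: "0 < K"
    "\<And>u. u \<in> {0..1} \<Longrightarrow> norm (neg_part (T z2 u + \<delta>)) \<le> K"
    unfolding bounded_pos by blast
  define \<kappa> where "\<kappa> = min (\<kappa>0 / 2) (e / (2 * K))"
  have \<kappa>: "0 < \<kappa>" "\<kappa> < \<kappa>0" using \<kappa>0 e K by (auto simp: \<kappa>_def)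
  have "K * \<kappa> \<le> K * (e / (2 * K))" using K by (intro mult_left_mono) (auto simp: \<kappa>_def)
  then have K\<kappa>: "K * \<kappa> \<le> e / 2" using K by simp
  have split: "excess \<delta> z = integral {0..\<kappa>} (\<lambda>u. neg_part (T z u + \<delta>)) + integral {\<kappa>..b} (\<lambda>u. neg_part (T z u + \<delta>))"
    if "z1 \<le> z" "z \<le> z2" for z
  proof -
    let ?f = "\<lambda>u. neg_part (T z u + \<delta>)"
    have i: "?f integrable_on {0..1}" using that z by (intro integrable_continuous_real neg_part_T_cont) auto
    have "integral {0..b} ?f + integral {b..1} ?f = integral {0..1} ?f"
      using i \<kappa>0 by (intro Henstock_Kurzweil_Integration.integral_combine) auto
    moreover have "integral {b..1} ?f = integral {b..1} (\<lambda>u. 0)"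
      using pos[OF that] by (intro integral_cong) (auto simp: less_imp_le)
    moreover have "integral {0..\<kappa>} ?f + integral {\<kappa>..b} ?f = integral {0..b} ?f"
      using \<kappa> \<kappa>0 by (intro Henstock_Kurzweil_Integration.integral_combine integrable_subinterval_real[OF i]) auto
    ultimately show ?thesis by (simp add: excess_def)
  qed
  have "norm (integral {0..\<kappa>} (\<lambda>u. neg_part (T z2 u + \<delta>))) \<le> K * (\<kappa> - 0)"
    using \<kappa> \<kappa>0 K z by (intro integral_bound continuous_on_subset[OF neg_part_T_cont]) auto
  moreover have "0 \<le> integral {0..\<kappa>} (\<lambda>u. neg_part (T z1 u + \<delta>))"
    using \<kappa> \<kappa>0 z by (intro Henstock_Kurzweil_Integration.integral_nonneg integrable_continuous_real
        continuous_on_subset[OF neg_part_T_cont] neg_part_nonneg) auto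
  ultimately show "excess \<delta> z2 \<le> excess \<delta> z1 + e"
    using split[of z1] split[of z2] z le[OF \<kappa>] e1(2) K\<kappa> by simp
qed

text \<open>\<open>T 0\<close> is nonnegative almost everywhere. Where \<open>T z + \<delta>\<close>
  is at most 0, its distance from 0 is therefore at most the distance between \<open>T z\<close> and
  \<open>T 0\<close>.\<close>

lemma excess_le_L2:
  assumes z: "0 < z" and \<delta>: "0 < \<delta>"
  shows "excess \<delta> z \<le> (L2_norm_on {0<..<1} (\<lambda>u. T z u - T 0 u))\<^sup>2"
proof -
  let ?f = "\<lambda>u. neg_part (T z u + \<delta>)"
  have "integrable (lebesgue_on {0..1}) ?f"
    using neg_part_T_cont[OF z] by (rule continuous_imp_integrable_real)
  then have i: "integrable (lebesgue_on {0<..<1}) ?f"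
    by (rule integrable_lebesgue_on_mono) auto
  have "excess \<delta> z = (\<integral>u. ?f u \<partial>lebesgue_on {0<..<1})"
    using lebesgue_integral_eq_integral[OF i] by (simp add: excess_def integral_open_interval_real)
  also have "\<dots> \<le> (\<integral>u. (T z u - T 0 u)\<^sup>2 \<partial>lebesgue_on {0<..<1})"
  proof (rule integral_mono_AE[OF i])
    show "integrable (lebesgue_on {0<..<1}) (\<lambda>u. (T z u - T 0 u)\<^sup>2)"
      using z by (intro L2_on_diff_integrable T_L2) auto
    show "AE u in lebesgue_on {0<..<1}. ?f u \<le> (T z u - T 0 u)\<^sup>2"
      using T_0 \<phi>_nonneg
    proof eventually_elim
      case (elim u)
      show ?case
      proof (cases "T z u + \<delta> \<le> 0")
        case True
        then have "?f u \<le> (T z u + \<delta>)\<^sup>2" by (rule neg_part_le)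
        also have "\<dots> \<le> (T z u - T 0 u)\<^sup>2" using True elim \<delta>
          by (simp add: abs_le_square_iff[symmetric])
        finally show ?thesis .
      qed (simp add: neg_part_def)
    qed
  qed
  also have "\<dots> = (L2_norm_on {0<..<1} (\<lambda>u. T z u - T 0 u))\<^sup>2"
    unfolding L2_norm_on_def by simp
  finally show ?thesis .
qed

lemma T_lim_right: "((\<lambda>z. L2_norm_on {0<..<1} (\<lambda>u. T z u - T 0 u)) \<longlongrightarrow> 0) (at_right 0)"
  using T_lim by (rule tendsto_within_subset) auto

text \<open>\<open>excess\<close> at \<open>z\<close> is at most \<open>excess\<close> at any
  earlier time, which tends to 0 by \<open>excess_le_L2\<close>. A continuous nonnegative integrand
  with integral 0 vanishes, and \<open>\<delta>\<close> is arbitrary.\<close>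

theorem T_nonneg:
  assumes z: "0 < z" and u: "0 \<le> u" "u \<le> 1"
  shows "0 \<le> T z u"
proof (rule field_le_epsilon)
  fix \<delta> :: real assume \<delta>: "0 < \<delta>"
  let ?f = "\<lambda>u. neg_part (T z u + \<delta>)"
  have "excess \<delta> z \<le> 0"
  proof (rule tendsto_lowerbound)
    show "((\<lambda>z. (L2_norm_on {0<..<1} (\<lambda>u. T z u - T 0 u))\<^sup>2) \<longlongrightarrow> 0) (at_right 0)"
      using tendsto_power[OF T_lim_right, of 2] by simp
    have "\<forall>\<^sub>F z' in at_right 0. z' \<in> {0<..<z}" by (rule eventually_at_right_real[OF z])
    then show "\<forall>\<^sub>F z' in at_right 0. excess \<delta> z \<le> (L2_norm_on {0<..<1} (\<lambda>u. T z' u - T 0 u))\<^sup>2"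
    proof eventually_elim
      case (elim z')
      then have "excess \<delta> z \<le> excess \<delta> z'" by (intro excess_antimono \<delta>) auto
      also have "\<dots> \<le> (L2_norm_on {0<..<1} (\<lambda>u. T z' u - T 0 u))\<^sup>2"
        using elim by (intro excess_le_L2 \<delta>) auto
      finally show ?case .
    qed
  qed simp
  moreover have "0 \<le> excess \<delta> z" unfolding excess_def using z
    by (intro Henstock_Kurzweil_Integration.integral_nonneg integrable_continuous_real neg_part_T_cont neg_part_nonneg)
  ultimately have "integral {0..1} ?f = 0" by (simp add: excess_def)
  then have "?f u = 0"
    using integral_eq_0_iff[OF neg_part_T_cont[OF z]] neg_part_nonneg u by auto
  then show "0 \<le> T z u + \<delta>" by (rule neg_part_eq_0_imp)
qed

section \<open>Propagation of positivity up to the boundary\<close>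

lemma T_positive_somewhere:
  obtains z0 u0 where "0 < z0" "0 < u0" "u0 < 1" "0 < T z0 u0"
proof -
  have "\<exists>z0 u0. 0 < z0 \<and> 0 < u0 \<and> u0 < 1 \<and> 0 < T z0 u0"
  proof (rule ccontr)
    assume *: "\<not> ?thesis"
    \<comment> \<open>Otherwise \<open>T\<close> vanishes for all positive \<open>z\<close>, and
      attaining the initial value in the \<open>L2\<close> norm forces \<open>\<phi>\<close> to
      vanish almost everywhere.\<close>
    have 0: "T z u = 0" if "0 < z" "u \<in> {0<..<1}" for z u
    proof (rule antisym)
      show "T z u \<le> 0" using * that by (meson greaterThanLessThan_iff not_less)
      show "0 \<le> T z u" using that by (intro T_nonneg) auto
    qed
    have "L2_norm_on {0<..<1} (\<lambda>u. T z u - T 0 u) = L2_norm_on {0<..<1} (T 0)" if "0 < z" for z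
      unfolding L2_norm_on_def using 0[OF that]
      by (intro arg_cong[where f=sqrt] Bochner_Integration.integral_cong) auto
    then have "\<forall>\<^sub>F z in at_right 0. L2_norm_on {0<..<1} (\<lambda>u. T z u - T 0 u) = L2_norm_on {0<..<1} (T 0)"
      by (auto simp: eventually_at_right_field intro: exI[of _ 1])
    then have "((\<lambda>z::real. L2_norm_on {0<..<1} (T 0)) \<longlongrightarrow> 0) (at_right 0)"
      using T_lim_right by (rule Lim_transform_eventually[rotated])
    then have "L2_norm_on {0<..<1} (T 0) = 0" by (simp add: tendsto_const_iff)
    then have "(\<integral>u. (T 0 u)\<^sup>2 \<partial>lebesgue_on {0<..<1}) = 0" by (simp add: L2_norm_on_def)
    then have "AE u in lebesgue_on {0<..<1}. (T 0 u)\<^sup>2 = 0"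
      using T_L2[of 0] by (subst (asm) integral_nonneg_eq_0_iff_AE) (auto simp: L2_on_def)
    then have "AE u in lebesgue_on {0<..<1}. \<phi> u = 0" using T_0 by eventually_elim auto
    then show False using \<phi>_nonzero by simp
  qed
  then show ?thesis using that by blast
qed

text \<open>The flux of the wave has derivative \<open>k * l * (A' + l * A) * E\<close>, at least
  \<open>k * (\<alpha> * l^2 - \<beta> * |l|) * E\<close>, so the condition on
  \<open>\<sigma>\<close> makes the wave a subsolution. At the Neumann end a wave with
  \<open>l \<ge> 0\<close> gives \<open>T - w\<close> a nonpositive slope, as
  \<open>comparison\<close> asks.\<close>

lemma travelling_wave_le:
  assumes z: "0 < z1" and pq: "0 \<le> p" "p < q" "q \<le> 1" and k: "0 \<le> k"
    and \<sigma>: "\<sigma> + \<beta> * \<bar>l\<bar> \<le> \<alpha> * l\<^sup>2"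
    and w: "\<And>z u. w z u = k * (exp (l * u + \<sigma> * z - c) - 1)"
    and initial: "\<And>u. p \<le> u \<Longrightarrow> u \<le> q \<Longrightarrow> w z1 u \<le> T z1 u"
    and right: "\<And>z. z1 < z \<Longrightarrow> z \<le> z2 \<Longrightarrow> w z q \<le> T z q"
    and left: "(\<forall>z\<in>{z1<..z2}. w z p \<le> T z p) \<or> p = 0 \<and> 0 \<le> l"
    and zu: "z1 \<le> z" "z \<le> z2" "p \<le> u" "u \<le> q"
  shows "w z u \<le> T z u"
proof -
  define E where "E z u = exp (l * u + \<sigma> * z - c)" for z u :: real
  have E: "(E z has_real_derivative l * E z u) (at u)" "((\<lambda>s. E s u) has_real_derivative \<sigma> * E z u) (at z)" for z u
    unfolding E_def by (auto intro!: derivative_eq_intros)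
  have w: "w = (\<lambda>z u. k * (E z u - 1))" unfolding E_def using w by (simp add: fun_eq_iff)
  have "0 \<le> T z u - w z u"
  proof (rule comparison[where V = "\<lambda>z u. T z u - w z u"
        and Vu = "\<lambda>z u. Tu z u - k * l * E z u" and Vz = "\<lambda>z u. Tz z u - k * \<sigma> * E z u"
        and X = "\<lambda>z u. Tz z u - k * l * (A' u + l * A u) * E z u"])
    have "continuous_on ({z1..z2} \<times> {p..q}) (\<lambda>x. T (fst x) (snd x))"
      using pq by (intro continuous_on_subset[OF T_cont_on[OF z, of z2]]) auto
    then show "continuous_on ({z1..z2} \<times> {p..q}) (\<lambda>(z, u). T z u - w z u)"
      unfolding w E_def case_prod_beta by (intro continuous_intros)
  next
    fix z u assume "z1 < z" "z \<le> z2" "p < u" "u < q"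
    then have zu: "0 < z" "0 < u" "u < 1" using z pq by auto
    show "((\<lambda>u. T z u - w z u) has_real_derivative Tu z u - k * l * E z u) (at u)"
      unfolding w by (auto intro!: derivative_eq_intros Tu_at zu E)
    show "((\<lambda>s. T s u - w s u) has_real_derivative Tz z u - k * \<sigma> * E z u) (at z)"
      unfolding w using zu by (auto intro!: derivative_eq_intros Tz E)
    have "((\<lambda>v. A v * Tu z v - k * l * (A v * E z v)) has_real_derivative
        Tz z u - k * l * (A' u * E z u + l * E z u * A u)) (at u)"
      using zu by (intro DERIV_diff DERIV_cmult DERIV_mult ATu A_deriv E) auto
    then show "((\<lambda>v. A v * (Tu z v - k * l * E z v)) has_real_derivative
        Tz z u - k * l * (A' u + l * A u) * E z u) (at u)"
      by (simp add: algebra_simps)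
    have "\<bar>l * A' u\<bar> \<le> \<beta> * \<bar>l\<bar>" using A'_le[of u] zu by (simp add: abs_mult mult.commute[of \<beta>] mult_left_mono)
    moreover have "\<alpha> * l\<^sup>2 \<le> A u * l\<^sup>2" using A_ge[of u] zu by (intro mult_right_mono) auto
    ultimately have "\<sigma> \<le> l * A' u + A u * l\<^sup>2" using \<sigma> by (simp add: abs_le_iff)
    then have "k * E z u * \<sigma> \<le> k * E z u * (l * A' u + A u * l\<^sup>2)"
      using k by (intro mult_left_mono) (auto simp: E_def)
    then show "Tz z u - k * l * (A' u + l * A u) * E z u \<le> Tz z u - k * \<sigma> * E z u"
      by (simp add: algebra_simps power2_eq_square)
  next
    show "(\<forall>z\<in>{z1<..z2}. 0 \<le> T z p - w z p) \<or>
      (\<forall>z\<in>{z1<..z2}. \<exists>D\<le>0. ((\<lambda>u. T z u - w z u) has_real_derivative D) (at p within {p..q}))"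
      using left
    proof
      assume l: "p = 0 \<and> 0 \<le> l"
      have "\<exists>D\<le>0. ((\<lambda>u. T z u - w z u) has_real_derivative D) (at p within {p..q})" if "z \<in> {z1<..z2}" for z
      proof (intro exI conjI)
        have "(T z has_real_derivative 0) (at p within {p..q})"
          using Tu_within[of z 0] neumann[of z] that z l pq
          by (intro DERIV_subset[where s = "{0..1}" and t = "{p..q}"]) auto
        then show "((\<lambda>u. T z u - w z u) has_real_derivative 0 - k * (l * E z p)) (at p within {p..q})"
          unfolding w by (auto intro!: derivative_eq_intros has_field_derivative_at_within[OF E(1)])
        show "0 - k * (l * E z p) \<le> 0" using k l by (auto simp: E_def)
      qed
      then show ?thesis by blast
    qed auto
  qed (use pq initial right zu in auto)
  then show ?thesis by simp
qed

text \<open>\<open>T\<close> stays above some \<open>m\<close> at an interior point \<open>p\<close>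
  for a short time, and two barriers start from there. A wave decreasing in \<open>u\<close> gives
  the linear bound up to the Dirichlet end; an increasing one covers \<open>[0, p]\<close>.\<close>

theorem T_hopf:
  obtains z2 c where "0 < z2" "0 < c" "\<And>u. 0 \<le> u \<Longrightarrow> u \<le> 1 \<Longrightarrow> c * (1 - u) \<le> T z2 u"
proof -
  obtain z1 p where p: "0 < z1" "0 < p" "p < 1" "0 < T z1 p" by (rule T_positive_somewhere)
  define m where "m = T z1 p / 2"
  have m: "0 < m" "m < T z1 p" using p by (auto simp: m_def)
  have "isCont (\<lambda>s. T s p) z1" using Tz[of z1 p] p by (auto intro: DERIV_isCont)
  then have "\<forall>\<^sub>F s in at_right z1. m < T s p"
    unfolding continuous_within
    using m by (intro order_tendstoD(1)[where y = "T z1 p"]) (auto intro: tendsto_within_subset)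
  then obtain z' where z': "z1 < z'" "\<And>s. z1 < s \<Longrightarrow> s < z' \<Longrightarrow> m < T s p"
    by (auto simp: eventually_at_right_field)
  define z2 where "z2 = (z1 + z') / 2"
  have z2: "z1 < z2" "z2 < z'" using z' by (auto simp: z2_def)
  have T_p: "m \<le> T s p" if "z1 \<le> s" "s \<le> z2" for s
    using that z2 z'(2)[of s] m by (cases "s = z1") auto
  define \<tau> where "\<tau> = z2 - z1"
  have \<tau>: "0 < \<tau>" using z2 by (simp add: \<tau>_def)
  have \<beta>: "0 \<le> \<beta>" using order_trans[OF abs_ge_zero A'_le[of 0]] by simp
  \<comment> \<open>A wave with rate \<open>\<sigma> = x / \<tau> * l\<close> travels the distance
    \<open>x\<close> in time \<open>\<tau>\<close>. For large \<open>l\<close> the quadratic term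
    outweighs both linear ones.\<close>
  have slope: "\<exists>l>0. x / \<tau> * l + \<beta> * l \<le> \<alpha> * l\<^sup>2" if "0 \<le> x" for x
  proof (intro exI conjI)
    let ?l = "(x / \<tau> + \<beta> + 1) / \<alpha>"
    show l: "0 < ?l" using that \<tau> \<beta> \<alpha>_pos by (intro divide_pos_pos add_nonneg_pos) auto
    have "(x / \<tau> + \<beta>) * ?l \<le> (\<alpha> * ?l) * ?l" using l \<alpha>_pos by (intro mult_right_mono) auto
    then show "x / \<tau> * ?l + \<beta> * ?l \<le> \<alpha> * ?l\<^sup>2"
      unfolding power2_eq_square distrib_right mult.assoc .
  qed
  have right: "\<exists>c>0. \<forall>u\<in>{p..1}. c * (1 - u) \<le> T z2 u"
  proof -
    obtain l where l: "0 < l" "(1 - p) / \<tau> * l + \<beta> * l \<le> \<alpha> * l\<^sup>2" using slope[of "1 - p"] p by auto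
    \<comment> \<open>With this speed the zero of the wave starts at \<open>p\<close> and reaches \<open>1\<close> exactly at time \<open>z2\<close>;
      a steep wave is a subsolution because \<open>\<sigma>\<close> is only linear in \<open>l\<close>.\<close>
    define \<sigma> where "\<sigma> = (1 - p) / \<tau> * l"
    have \<sigma>: "0 < \<sigma>" "\<sigma> * \<tau> = l * (1 - p)" using l p \<tau> by (auto simp: \<sigma>_def)
    \<comment> \<open>At \<open>u = p\<close> the exponential grows to
      \<open>exp (\<sigma> * \<tau>)\<close> by time \<open>z2\<close>, so this amplitude keeps the
      wave below \<open>m\<close> there.\<close>
    define k where "k = m / exp (\<sigma> * \<tau>)"
    have k: "0 < k" "k * exp (\<sigma> * \<tau>) = m" using m by (auto simp: k_def)
    define w where "w z u = k * (exp ((- l) * u + \<sigma> * z - (\<sigma> * z1 - l * p)) - 1)" for z u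
    have "w z2 u \<le> T z2 u" if u: "u \<in> {p..1}" for u
    proof (rule travelling_wave_le[OF p(1), of p 1 k \<sigma> "-l" w "\<sigma> * z1 - l * p" z2])
      show "\<sigma> + \<beta> * \<bar>- l\<bar> \<le> \<alpha> * (- l)\<^sup>2" using l by (simp add: \<sigma>_def)
      show "w z1 u \<le> T z1 u" if "p \<le> u" "u \<le> 1" for u
      proof -
        have "w z1 u \<le> k * 0" unfolding w_def using k that l by (intro mult_left_mono) (auto simp: algebra_simps)
        then show ?thesis using T_nonneg[of z1 u] p that by simp
      qed
      show "w z 1 \<le> T z 1" if "z1 < z" "z \<le> z2" for z
      proof -
        have "\<sigma> * (z - z1) \<le> \<sigma> * \<tau>" using \<sigma> that by (intro mult_left_mono) (auto simp: \<tau>_def)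
        then have "w z 1 \<le> k * 0" unfolding w_def using k \<sigma> by (intro mult_left_mono) (auto simp: algebra_simps)
        then show ?thesis using dirichlet[of z] p that by simp
      qed
      have "w z p \<le> T z p" if "z \<in> {z1<..z2}" for z
      proof -
        have "\<sigma> * (z - z1) \<le> \<sigma> * \<tau>" using \<sigma> that by (intro mult_left_mono) (auto simp: \<tau>_def)
        then have "w z p \<le> k * exp (\<sigma> * \<tau>)" unfolding w_def using k by (intro mult_left_mono) (auto simp: algebra_simps intro: order_trans[of _ "exp (\<sigma> * \<tau>)"])
        then show ?thesis using k T_p[of z] that by simp
      qed
      then show "(\<forall>z\<in>{z1<..z2}. w z p \<le> T z p) \<or> p = 0 \<and> 0 \<le> - l" by blast
    qed (use p k z2 u in \<open>auto simp: w_def\<close>)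
    \<comment> \<open>\<open>exp x - 1 \<ge> x\<close> turns the exponential profile into the linear
      one.\<close>
    moreover have "k * l * (1 - u) \<le> w z2 u" for u
    proof -
      have "w z2 u = k * (exp (l * (1 - u)) - 1)" unfolding w_def using \<sigma>(2) by (simp add: algebra_simps \<tau>_def)
      moreover have "k * (l * (1 - u)) \<le> k * (exp (l * (1 - u)) - 1)"
        using k(1) exp_ge_add_one_self[of "l * (1 - u)"] by (intro mult_left_mono) linarith+
      ultimately show ?thesis by simp
    qed
    ultimately show ?thesis using k l by (intro exI[of _ "k * l"]) (meson atLeastAtMost_iff mult_pos_pos order_trans)
  qed
  have left: "\<exists>c>0. \<forall>u\<in>{0..p}. c \<le> T z2 u"
  proof -
    obtain l where l: "0 < l" "2 * p / \<tau> * l + \<beta> * l \<le> \<alpha> * l\<^sup>2" using slope[of "2 * p"] p by auto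
    \<comment> \<open>Travelling the distance \<open>2 * p\<close> takes the zero of the wave from
      \<open>p\<close> to \<open>- p\<close>, so at time \<open>z2\<close> the wave is bounded away
      from 0 on \<open>[0, p]\<close>.\<close>
    define \<sigma> where "\<sigma> = 2 * p / \<tau> * l"
    have \<sigma>: "0 < \<sigma>" "\<sigma> * \<tau> = 2 * l * p" using l p \<tau> by (auto simp: \<sigma>_def)
    define k where "k = m / exp (\<sigma> * \<tau>)"
    have k: "0 < k" "k * exp (\<sigma> * \<tau>) = m" using m by (auto simp: k_def)
    define w where "w z u = k * (exp (l * u + \<sigma> * z - (\<sigma> * z1 + l * p)) - 1)" for z u
    have "w z2 u \<le> T z2 u" if u: "u \<in> {0..p}" for u
    proof (rule travelling_wave_le[OF p(1), of 0 p k \<sigma> l w "\<sigma> * z1 + l * p" z2])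
      show "\<sigma> + \<beta> * \<bar>l\<bar> \<le> \<alpha> * l\<^sup>2" using l by (simp add: \<sigma>_def)
      show "w z1 u \<le> T z1 u" if "0 \<le> u" "u \<le> p" for u
      proof -
        have "w z1 u \<le> k * 0" unfolding w_def using k that l by (intro mult_left_mono) (auto simp: algebra_simps)
        then show ?thesis using T_nonneg[of z1 u] p that by simp
      qed
      show "w z p \<le> T z p" if "z1 < z" "z \<le> z2" for z
      proof -
        have "\<sigma> * (z - z1) \<le> \<sigma> * \<tau>" using \<sigma> that by (intro mult_left_mono) (auto simp: \<tau>_def)
        then have "w z p \<le> k * exp (\<sigma> * \<tau>)" unfolding w_def using k by (intro mult_left_mono) (auto simp: algebra_simps intro: order_trans[of _ "exp (\<sigma> * \<tau>)"])
        then show ?thesis using k T_p[of z] that by simp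
      qed
    qed (use p k z2 u l in \<open>auto simp: w_def\<close>)
    moreover have "k * (l * p) \<le> w z2 u" if "u \<in> {0..p}" for u
    proof -
      have "w z2 u = k * (exp (l * (u + p)) - 1)" unfolding w_def using \<sigma>(2) by (simp add: algebra_simps \<tau>_def)
      moreover have "l * p \<le> l * (u + p)" using l that by simp
      then have "k * (l * p) \<le> k * (exp (l * (u + p)) - 1)"
        using k(1) exp_ge_add_one_self[of "l * (u + p)"] by (intro mult_left_mono) linarith+
      ultimately show ?thesis by simp
    qed
    ultimately show ?thesis using k l p by (intro exI[of _ "k * (l * p)"]) (meson mult_pos_pos order_trans)
  qed
  obtain c1 c2 where c: "0 < c1" "\<And>u. u \<in> {p..1} \<Longrightarrow> c1 * (1 - u) \<le> T z2 u"
    "0 < c2" "\<And>u. u \<in> {0..p} \<Longrightarrow> c2 \<le> T z2 u" using left right by blast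
  show ?thesis
  proof (rule that[of z2 "min c1 c2"])
    fix u :: real assume u: "0 \<le> u" "u \<le> 1"
    show "min c1 c2 * (1 - u) \<le> T z2 u"
    proof (cases "p \<le> u")
      case True
      have "min c1 c2 * (1 - u) \<le> c1 * (1 - u)" using u by (intro mult_right_mono) auto
      also have "\<dots> \<le> T z2 u" using c True u by auto
      finally show ?thesis .
    next
      case False
      have "min c1 c2 * (1 - u) \<le> c2 * 1" using u c by (intro mult_mono) auto
      also have "\<dots> \<le> T z2 u" using c(4)[of u] False u by auto
      finally show ?thesis .
    qed
  qed (use p z2 c in auto)
qed

end

subsection \<open>The decay rate\<close>

lemma (in sturm_liouville) diffusivity_inverse_poly:
  obtains A' \<alpha> \<beta> where "diffusivity (\<lambda>u. 1 / poly r u) A' \<alpha> \<beta>"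
proof -
  obtain M where M: "\<And>u. u \<in> {0..1} \<Longrightarrow> poly r u \<le> M" "0 < M" using r_bound by blast
  have r: "poly r u \<noteq> 0" if "u \<in> {0..1}" for u using r_pos[OF that] by simp
  define A' where "A' u = - poly (pderiv r) u / (poly r u)\<^sup>2" for u
  have "continuous_on {0..1} A'"
    unfolding A'_def using r by (intro continuous_intros) auto
  then have "bounded (A' ` {0..1})"
    by (intro compact_imp_bounded compact_continuous_image) auto
  then obtain \<beta> where \<beta>: "\<And>u. u \<in> {0..1} \<Longrightarrow> norm (A' u) \<le> \<beta>"
    unfolding bounded_iff by blast
  have "diffusivity (\<lambda>u. 1 / poly r u) A' (1 / M) \<beta>"
  proof
    fix u :: real assume "0 < u" "u < 1"
    then have "poly r u \<noteq> 0" using r by simp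
    then show "((\<lambda>u. 1 / poly r u) has_real_derivative A' u) (at u)"
      unfolding A'_def by (auto intro!: derivative_eq_intros poly_DERIV simp: power2_eq_square)
  next
    show "continuous_on {0..1} (\<lambda>u. 1 / poly r u)" using r by (intro continuous_intros) auto
  qed (use M \<beta> r_pos in \<open>auto simp: frac_le\<close>)
  then show ?thesis by (rule that)
qed

section \<open>Comparison with separated solutions\<close>

locale polynomial_diffusion = sturm_liouville r + diffusion "\<lambda>u. 1 / poly r u" A' \<alpha> \<beta> \<phi> T Tu Tz
  for r A' \<alpha> \<beta> \<phi> T Tu Tz
begin

text \<open>The product of the exponential and \<open>Phi L\<close> solves the equation with the
  Neumann condition, so \<open>comparison\<close> applies to its difference from \<open>T\<close>.
  \<open>s = 1\<close> yields lower bounds and \<open>s = - 1\<close> upper bounds; the premise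
  \<open>right\<close> is the sign at the Dirichlet end, where \<open>T\<close> is zero.\<close>

lemma separated_comparison:
  assumes z0: "0 < z0" and L: "0 \<le> L"
    and initial: "\<And>u. 0 \<le> u \<Longrightarrow> u \<le> 1 \<Longrightarrow> 0 \<le> s * (T z0 u - k * Phi L u)"
    and right: "0 \<le> - s * k * Phi L 1"
    and zu: "z0 \<le> z" "0 \<le> u" "u \<le> 1"
  shows "0 \<le> s * (T z u - k * (exp (- L * (z - z0)) * Phi L u))"
proof -
  define e where "e z = exp (- L * (z - z0))" for z
  have e: "(e has_real_derivative - L * e z) (at z)" "0 < e z" "e z0 = 1" for z
    unfolding e_def by (auto intro!: derivative_eq_intros)
  have PhiW: "(Phi L has_real_derivative poly r u * W L u) (at u)"
    "(W L has_real_derivative - L * Phi L u) (at u)" if "0 < u" "u < 1" for u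
    using Phi_W_deriv(1,2)[OF L, of u] that by (simp_all add: at_within_Icc_at)
  have "0 \<le> s * (T z u - k * (e z * Phi L u))"
  proof (rule comparison[where V = "\<lambda>z u. s * (T z u - k * (e z * Phi L u))"
        and Vu = "\<lambda>z u. s * (Tu z u - k * (e z * (poly r u * W L u)))"
        and Vz = "\<lambda>z u. s * (Tz z u - k * ((- L * e z) * Phi L u))"
        and X = "\<lambda>z u. s * (Tz z u - k * (e z * (- L * Phi L u)))"
        and ?z1.0 = z0 and ?z2.0 = z and p = 0 and q = 1])
    show "continuous_on ({z0..z} \<times> {0..1}) (\<lambda>(z, u). s * (T z u - k * (e z * Phi L u)))"
      unfolding case_prod_beta e_def
      by (intro continuous_intros T_cont_on z0 continuous_on_compose2[OF Phi_cont[OF L]]) auto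
  next
    fix x v assume "z0 < x" "x \<le> z" "0 < v" "v < (1::real)"
    then have xv: "0 < x" "0 < v" "v < 1" using z0 by auto
    show "((\<lambda>u. s * (T x u - k * (e x * Phi L u))) has_real_derivative
        s * (Tu x v - k * (e x * (poly r v * W L v)))) (at v)"
      by (intro DERIV_cmult DERIV_diff Tu_at PhiW xv)
    show "((\<lambda>z. s * (T z v - k * (e z * Phi L v))) has_real_derivative
        s * (Tz x v - k * ((- L * e x) * Phi L v))) (at x)"
      using xv by (intro DERIV_cmult DERIV_diff Tz DERIV_cmult_right e) auto
    \<comment> \<open>The flux of the product is a multiple of \<open>W\<close>, by cancelling
      \<open>r\<close> against \<open>1 / r\<close>; the cancellation is made on the open interval,
      where \<open>r\<close> is positive.\<close>
    have "((\<lambda>v. s * (1 / poly r v * Tu x v - k * (e x * W L v))) has_real_derivative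
        s * (Tz x v - k * (e x * (- L * Phi L v)))) (at v)"
      using xv by (intro DERIV_cmult DERIV_diff ATu PhiW) auto
    then show "((\<lambda>v. 1 / poly r v * (s * (Tu x v - k * (e x * (poly r v * W L v))))) has_real_derivative
        s * (Tz x v - k * (e x * (- L * Phi L v)))) (at v)"
    proof (rule has_field_derivative_transform_within_open)
      fix y :: real assume "y \<in> {0<..<1}"
      then have "poly r y \<noteq> 0" using r_pos[of y] by simp
      then show "s * (1 / poly r y * Tu x y - k * (e x * W L y)) =
          1 / poly r y * (s * (Tu x y - k * (e x * (poly r y * W L y))))"
        by (simp add: field_simps)
    qed (use xv in auto)
  next
    have "((\<lambda>u. s * (T x u - k * (e x * Phi L u))) has_real_derivative
        s * (Tu x 0 - k * (e x * (poly r 0 * W L 0)))) (at 0 within {0..1})" if "x \<in> {z0<..z}" for x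
      using that z0 by (intro DERIV_cmult DERIV_diff Tu_within Phi_W_deriv L) auto
    moreover have "s * (Tu x 0 - k * (e x * (poly r 0 * W L 0))) \<le> 0" if "x \<in> {z0<..z}" for x
      using that z0 neumann[of x] Phi_W_deriv(4)[OF L, of 0] by simp
    ultimately show "(\<forall>x\<in>{z0<..z}. 0 \<le> s * (T x 0 - k * (e x * Phi L 0))) \<or>
      (\<forall>x\<in>{z0<..z}. \<exists>D\<le>0. ((\<lambda>u. s * (T x u - k * (e x * Phi L u))) has_real_derivative D) (at 0 within {0..1}))"
      by blast
  next
    fix x assume "z0 < x" "x \<le> z"
    then have "T x 1 = 0" using dirichlet z0 by simp
    moreover have "0 \<le> e x * (- s * k * Phi L 1)" by (rule mult_nonneg_nonneg[OF less_imp_le[OF e(2)] right])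
    ultimately show "0 \<le> s * (T x 1 - k * (e x * Phi L 1))" by (simp add: mult_ac)
  qed (use zu initial e in \<open>auto simp: mult_ac\<close>)
  then show ?thesis by (simp add: e_def)
qed

text \<open>\<open>Phi L\<close> is bounded below by some \<open>c > 0\<close> on the closed
  interval, so the multiple \<open>B / c\<close> of it lies above \<open>T z0\<close>.\<close>

lemma upper_bound:
  assumes L: "0 \<le> L" and pos: "\<And>u. u \<in> {0..1} \<Longrightarrow> 0 < Phi L u" and z0: "0 < z0"
  obtains K where "\<And>z u. z0 \<le> z \<Longrightarrow> u \<in> {0..1} \<Longrightarrow> T z u \<le> K * exp (- L * (z - z0))"
    and "0 < K"
proof -
  have "\<exists>x\<in>{0..1}. \<forall>y\<in>{0..1}. Phi L x \<le> Phi L y"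
    by (intro continuous_attains_inf Phi_cont L) auto
  then obtain c where c: "0 < c" "\<And>y. y \<in> {0..1} \<Longrightarrow> c \<le> Phi L y" using pos by blast
  have "bounded (T z0 ` {0..1})" "bounded (Phi L ` {0..1})"
    using T_cont_u[OF z0] Phi_cont[OF L] by (auto intro!: compact_imp_bounded compact_continuous_image)
  then obtain B P where B: "0 < B" "\<And>u. u \<in> {0..1} \<Longrightarrow> norm (T z0 u) \<le> B"
    and P: "0 < P" "\<And>u. u \<in> {0..1} \<Longrightarrow> norm (Phi L u) \<le> P"
    unfolding bounded_pos by blast
  define k where "k = B / c"
  have k: "0 < k" using B c by (simp add: k_def)
  show ?thesis
  proof (rule that[of "k * P"])
    fix z u :: real assume z: "z0 \<le> z" and u: "u \<in> {0..1}"
    have "0 \<le> (- 1) * (T z u - k * (exp (- L * (z - z0)) * Phi L u))"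
    proof (rule separated_comparison[OF z0 L])
      fix v :: real assume v: "0 \<le> v" "v \<le> 1"
      have "T z0 v \<le> k * c" using B(2)[of v] v c by (simp add: k_def)
      also have "\<dots> \<le> k * Phi L v" using c(2)[of v] v k by (intro mult_left_mono) auto
      finally show "0 \<le> (- 1) * (T z0 v - k * Phi L v)" by simp
    next
      show "0 \<le> - (- 1) * k * Phi L 1" using k pos[of 1] by simp
    qed (use z u in auto)
    moreover have "k * (exp (- L * (z - z0)) * Phi L u) \<le> k * (exp (- L * (z - z0)) * P)"
      using P(2)[OF u] k by (intro mult_left_mono) auto
    ultimately show "T z u \<le> k * P * exp (- L * (z - z0))" by (simp add: mult_ac)
  qed (use k P in auto)
qed

text \<open>Both profiles are measured against \<open>1 - u\<close>: \<open>T z0\<close> lies above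
  \<open>c * (1 - u)\<close> by \<open>T_hopf\<close>, and \<open>Phi L\<close>, vanishing at 1 with
  bounded slope, lies below \<open>C * (1 - u)\<close>. This gives \<open>k = c / C\<close>.\<close>

lemma lower_bound:
  assumes L: "0 \<le> L" and zero: "Phi L 1 = 0"
  obtains z0 k where "0 < z0" "0 < k"
    "\<And>z u. z0 \<le> z \<Longrightarrow> u \<in> {0..1} \<Longrightarrow> k * exp (- L * (z - z0)) * Phi L u \<le> T z u"
proof -
  obtain z0 c where z0: "0 < z0" and c: "0 < c" "\<And>u. 0 \<le> u \<Longrightarrow> u \<le> 1 \<Longrightarrow> c * (1 - u) \<le> T z0 u"
    using T_hopf by blast
  have "bounded ((\<lambda>u. poly r u * W L u) ` {0..1})"
    by (intro compact_imp_bounded compact_continuous_image continuous_intros W_cont L) auto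
  then obtain C where C: "0 < C" "\<And>u. u \<in> {0..1} \<Longrightarrow> norm (poly r u * W L u) \<le> C"
    unfolding bounded_pos by blast
  have lin: "Phi L u \<le> C * (1 - u)" if u: "0 \<le> u" "u \<le> 1" for u
  proof (cases "u = 1")
    case False
    then obtain x where x: "u < x" "x < 1" "Phi L 1 - Phi L u = (1 - u) * (poly r x * W L x)"
      using mvt_unit_interval[OF Phi_W_deriv(1)[OF L], of u 1] u by auto
    have "(1 - u) * (- (poly r x * W L x)) \<le> (1 - u) * C"
      using C(2)[of x] x u by (intro mult_left_mono) auto
    then show ?thesis using x(3) zero by (simp add: algebra_simps)
  qed (simp add: zero)
  define k where "k = c / C"
  have k: "0 < k" using c C by (simp add: k_def)
  show ?thesis
  proof (rule that[OF z0 k])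
    fix z u :: real assume z: "z0 \<le> z" and u: "u \<in> {0..1}"
    have "0 \<le> 1 * (T z u - k * (exp (- L * (z - z0)) * Phi L u))"
    proof (rule separated_comparison[OF z0 L])
      fix v :: real assume v: "0 \<le> v" "v \<le> 1"
      have "k * Phi L v \<le> k * (C * (1 - v))" using lin[OF v] k by (intro mult_left_mono) auto
      also have "\<dots> \<le> T z0 v" using c(2)[OF v] C(1) by (simp add: k_def)
      finally show "0 \<le> 1 * (T z0 v - k * Phi L v)" by simp
    qed (use zero z u in auto)
    then show "k * exp (- L * (z - z0)) * Phi L u \<le> T z u" by (simp add: mult_ac)
  qed
qed

text \<open>The lower bound is used with \<open>\<Lambda>\<close> itself and the upper bound with
  every \<open>L < \<Lambda>\<close> close to it; the multiplicative constants disappear from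
  \<open>1 / z * ln\<close> in the limit.\<close>

theorem decay_rate:
  assumes \<Lambda>: "0 < \<Lambda>"
    "\<And>L u. 0 \<le> L \<Longrightarrow> L < \<Lambda> \<Longrightarrow> u \<in> {0..1} \<Longrightarrow> 0 < Phi L u"
    "\<And>u. u \<in> {0..<1} \<Longrightarrow> 0 < Phi \<Lambda> u" "Phi \<Lambda> 1 = 0"
    and u: "u \<in> {0..<1}"
  shows "\<forall>\<^sub>F z in at_top. 0 < T z u" and "((\<lambda>z. 1 / z * ln (T z u)) \<longlongrightarrow> - \<Lambda>) at_top"
proof -
  have u': "u \<in> {0..1}" using u by simp
  obtain z0 k where z0: "0 < z0" "0 < k"
    and low: "\<And>z u. z0 \<le> z \<Longrightarrow> u \<in> {0..1} \<Longrightarrow> k * exp (- \<Lambda> * (z - z0)) * Phi \<Lambda> u \<le> T z u"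
    using lower_bound[of \<Lambda>] \<Lambda> by (metis less_imp_le)
  have pos: "0 < T z u" if "z0 \<le> z" for z
  proof -
    have "0 < k * exp (- \<Lambda> * (z - z0)) * Phi \<Lambda> u" using z0 \<Lambda>(3)[OF u] by (intro mult_pos_pos) auto
    then show ?thesis using low[OF that u'] by linarith
  qed
  then show "\<forall>\<^sub>F z in at_top. 0 < T z u"
    unfolding eventually_at_top_linorder by blast
  have lim: "((\<lambda>z. 1 / z * (ln K - L * (z - z0))) \<longlongrightarrow> - L) at_top" for K L
  proof -
    have "((\<lambda>z. (ln K + L * z0) / z) \<longlongrightarrow> 0) at_top"
      by (rule tendsto_divide_0[OF tendsto_const filterlim_at_top_imp_at_infinity[OF filterlim_ident]])
    then have "((\<lambda>z. (ln K + L * z0) / z - L) \<longlongrightarrow> 0 - L) at_top" by (intro tendsto_diff tendsto_const)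
    moreover have "\<forall>\<^sub>F z in at_top. (ln K + L * z0) / z - L = 1 / z * (ln K - L * (z - z0))"
      using eventually_gt_at_top[of 0] by eventually_elim (simp add: field_simps)
    ultimately show ?thesis by (auto intro: Lim_transform_eventually)
  qed
  show "((\<lambda>z. 1 / z * ln (T z u)) \<longlongrightarrow> - \<Lambda>) at_top"
  proof (rule order_tendstoI)
    fix y assume y: "y < - \<Lambda>"
    have "\<forall>\<^sub>F z in at_top. y < 1 / z * (ln (k * Phi \<Lambda> u) - \<Lambda> * (z - z0))"
      using order_tendstoD(1)[OF lim y] .
    then show "\<forall>\<^sub>F z in at_top. y < 1 / z * ln (T z u)"
      using eventually_ge_at_top[of z0]
    proof eventually_elim
      case (elim z)
      have P: "0 < k * Phi \<Lambda> u" using z0 \<Lambda>(3)[OF u] by simp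
      have "ln (k * Phi \<Lambda> u) - \<Lambda> * (z - z0) = ln (k * Phi \<Lambda> u * exp (- \<Lambda> * (z - z0)))"
        using P by (subst ln_mult_pos) auto
      also have "\<dots> \<le> ln (T z u)"
      proof (rule ln_le_cancel_iff[THEN iffD2])
        show "0 < k * Phi \<Lambda> u * exp (- \<Lambda> * (z - z0))" by (rule mult_pos_pos[OF P exp_gt_zero])
        show "k * Phi \<Lambda> u * exp (- \<Lambda> * (z - z0)) \<le> T z u"
          using low[OF elim(2) u'] by (simp add: mult_ac)
      qed (rule pos[OF elim(2)])
      finally have "1 / z * (ln (k * Phi \<Lambda> u) - \<Lambda> * (z - z0)) \<le> 1 / z * ln (T z u)"
        using elim(2) z0 by (intro mult_left_mono) auto
      then show ?case using elim(1) by linarith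
    qed
  next
    fix y assume y: "- \<Lambda> < y"
    \<comment> \<open>The average of \<open>\<Lambda>\<close> and \<open>- y\<close> lies strictly
      between them, which gives \<open>L < \<Lambda>\<close> and \<open>- L < y\<close>; the bound
      \<open>\<Lambda> / 2\<close> keeps \<open>L\<close> nonnegative when \<open>y\<close> is
      large.\<close>
    define L where "L = max (\<Lambda> / 2) ((\<Lambda> - y) / 2)"
    have L: "0 \<le> L" "L < \<Lambda>" "- L < y" using y \<Lambda>(1) by (auto simp: L_def max_def field_simps)
    obtain K where K: "\<And>z u. z0 \<le> z \<Longrightarrow> u \<in> {0..1} \<Longrightarrow> T z u \<le> K * exp (- L * (z - z0))" "0 < K"
      using upper_bound[OF L(1) \<Lambda>(2)[OF L(1,2)] z0(1)] by metis
    have "\<forall>\<^sub>F z in at_top. 1 / z * (ln K - L * (z - z0)) < y"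
      using order_tendstoD(2)[OF lim L(3)] .
    then show "\<forall>\<^sub>F z in at_top. 1 / z * ln (T z u) < y"
      using eventually_ge_at_top[of z0]
    proof eventually_elim
      case (elim z)
      have "ln (T z u) \<le> ln (K * exp (- L * (z - z0)))"
        using K(1)[OF elim(2) u'] K(2) pos[OF elim(2)] by (subst ln_le_cancel_iff) auto
      also have "\<dots> = ln K - L * (z - z0)"
        using K(2) by (subst ln_mult_pos) auto
      finally have "1 / z * ln (T z u) \<le> 1 / z * (ln K - L * (z - z0))"
        using elim(2) z0 by (intro mult_left_mono) auto
      then show ?case using elim(1) by linarith
    qed
  qed
qed

end

text \<open>Eventual positivity of \<open>T L u\<close> accompanies the limit because
  \<open>ln\<close> is total: it certifies that the logarithms are those of positive
  numbers.\<close>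

theorem theorem5p3:
  fixes d n\<^sub>1 a :: real and \<gamma>\<^sub>0 :: "real \<times> real \<Rightarrow> real"
  assumes "d > 0" and "n\<^sub>1 > 1" and "a > 0"
    and "\<exists>C. C-lipschitz_on ({0..d} \<times> {0..d}) \<gamma>\<^sub>0"
    and "nonneg_kernel d \<gamma>\<^sub>0"
    and "S0 d \<gamma>\<^sub>0 > 0"
  shows "Lambda_infty (a_infty d n\<^sub>1 a \<gamma>\<^sub>0) > 0 \<and>
    (\<forall>\<phi> T. \<phi> \<in> L2_on {0<..<1} \<longrightarrow>
       \<not> (AE v in lebesgue_on {0<..<1}. \<phi> v = 0) \<longrightarrow>
       (AE v in lebesgue_on {0<..<1}. \<phi> v \<ge> 0) \<longrightarrow>
       diffusion_solution (a_infty d n\<^sub>1 a \<gamma>\<^sub>0) \<phi> T \<longrightarrow>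
       (\<forall>u\<in>{0..<1}.
          (\<forall>\<^sub>F L in at_top. T L u > 0) \<and>
          ((\<lambda>L. 1 / L * ln (T L u)) \<longlongrightarrow> - Lambda_infty (a_infty d n\<^sub>1 a \<gamma>\<^sub>0)) at_top))"
proof -
  define a\<^sub>0 where "a\<^sub>0 = a0 d n\<^sub>1 a \<gamma>\<^sub>0"
  define c where "c = 1 - pi\<^sup>2 / (a\<^sup>2 * d\<^sup>2)"
  define \<theta> where "\<theta> = theta n\<^sub>1"
  have c: "c \<le> 1" by (simp add: c_def)
  have "1 < n\<^sub>1\<^sup>2" using assms(2) by (simp add: one_less_power)
  moreover from this have "\<theta>\<^sup>2 = 1 - 1 / n\<^sub>1\<^sup>2"
    unfolding \<theta>_def theta_def by (intro real_sqrt_pow2) (simp add: divide_le_eq)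
  ultimately have \<theta>: "0 < \<theta>\<^sup>2" "\<theta>\<^sup>2 < 1"
    using assms(2) by (simp_all add: divide_less_eq)
  have a0: "0 < a\<^sub>0"
    unfolding a\<^sub>0_def a0_def using assms(1-3,6) \<theta> unfolding \<theta>_def
    by (intro divide_pos_pos mult_pos_pos) auto
  \<comment> \<open>The reciprocal of the diffusivity,
    \<open>(1 - c * \<theta>^2 * u^2) / a0\<close>, as a polynomial in \<open>u\<close>.\<close>
  define r where "r = [: 1 / a\<^sub>0, 0, - c * \<theta>\<^sup>2 / a\<^sub>0 :]"
  have A: "a_infty d n\<^sub>1 a \<gamma>\<^sub>0 = (\<lambda>u. 1 / poly r u)"
  proof
    fix u
    have "poly r u = (1 - c * (\<theta> * u)\<^sup>2) / a\<^sub>0"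
      using a0 by (simp add: r_def power2_eq_square field_simps)
    then show "a_infty d n\<^sub>1 a \<gamma>\<^sub>0 u = 1 / poly r u"
      by (simp add: a_infty_def a\<^sub>0_def c_def \<theta>_def)
  qed
  \<comment> \<open>From \<open>c \<le> 1\<close> and \<open>\<theta>^2 * u^2 < 1\<close> the
    product stays below 1, also when \<open>c\<close> is negative.\<close>
  interpret sturm_liouville r
  proof
    fix u :: real assume u: "u \<in> {0..1}"
    have "\<theta>\<^sup>2 * u\<^sup>2 \<le> \<theta>\<^sup>2" using u \<theta> by (intro mult_left_le) (auto simp: power_le_one)
    moreover have "\<theta>\<^sup>2 * u\<^sup>2 * c \<le> \<theta>\<^sup>2 * u\<^sup>2" using c by (intro mult_left_le) auto
    moreover have "c * (\<theta> * u)\<^sup>2 = \<theta>\<^sup>2 * u\<^sup>2 * c" by (simp add: power_mult_distrib mult_ac)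
    ultimately have "0 < 1 - c * (\<theta> * u)\<^sup>2" using \<theta>(2) by linarith
    then have "0 < (1 - c * (\<theta> * u)\<^sup>2) / a\<^sub>0" using a0 by (rule divide_pos_pos)
    also have "\<dots> = poly r u"
      using a0 by (simp add: r_def power2_eq_square field_simps)
    finally show "0 < poly r u" .
  qed
  obtain \<Lambda> where \<Lambda>: "0 < \<Lambda>"
    "\<And>L u. 0 \<le> L \<Longrightarrow> L < \<Lambda> \<Longrightarrow> u \<in> {0..1} \<Longrightarrow> 0 < Phi L u"
    "\<And>u. u \<in> {0..<1} \<Longrightarrow> 0 < Phi \<Lambda> u" "Phi \<Lambda> 1 = 0"
    using principal_eigenvalue by blast
  have \<Lambda>_eq: "Lambda_infty (\<lambda>u. 1 / poly r u) = \<Lambda>"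
    by (rule Lambda_infty_eq[OF \<Lambda>])
  obtain A' \<alpha> \<beta> where A': "diffusivity (\<lambda>u. 1 / poly r u) A' \<alpha> \<beta>"
    using diffusivity_inverse_poly by blast
  have "(\<forall>\<^sub>F L in at_top. T L u > 0) \<and> ((\<lambda>L. 1 / L * ln (T L u)) \<longlongrightarrow> - \<Lambda>) at_top"
    if \<phi>: "\<not> (AE v in lebesgue_on {0<..<1}. \<phi> v = 0)" "AE v in lebesgue_on {0<..<1}. \<phi> v \<ge> 0"
      and T: "diffusion_solution (\<lambda>u. 1 / poly r u) \<phi> T" and u: "u \<in> {0..<1}" for \<phi> T u
  proof -
    obtain Tu Tz where sol:
      "continuous_on ({0<..} \<times> {0..1}) (\<lambda>(z, u). T z u)"
      "continuous_on ({0<..} \<times> {0..<1}) (\<lambda>(z, u). Tu z u)"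
      "continuous_on ({0<..} \<times> {0<..<1}) (\<lambda>(z, u). Tz z u)"
      "\<forall>z>0. \<forall>u\<in>{0..<1}. (T z has_real_derivative Tu z u) (at u within {0..1})"
      "\<forall>z>0. \<forall>u\<in>{0<..<1}. ((\<lambda>s. T s u) has_real_derivative Tz z u) (at z)"
      "\<forall>z>0. \<forall>u\<in>{0<..<1}. ((\<lambda>v. 1 / poly r v * Tu z v) has_real_derivative Tz z u) (at u)"
      "\<forall>z>0. Tu z 0 = 0" "\<forall>z>0. T z 1 = 0"
      "AE u in lebesgue_on {0<..<1}. T 0 u = \<phi> u"
      "\<forall>z\<ge>0. T z \<in> L2_on {0<..<1}"
      "\<forall>z\<^sub>0\<ge>0. ((\<lambda>z. L2_norm_on {0<..<1} (\<lambda>u. T z u - T z\<^sub>0 u)) \<longlongrightarrow> 0) (at z\<^sub>0 within {0..})"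
      using T unfolding diffusion_solution_def by blast
    have "diffusion (\<lambda>u. 1 / poly r u) A' \<alpha> \<beta> \<phi> T Tu Tz"
      by (intro diffusion.intro A' diffusion_axioms.intro) (use sol \<phi> in simp_all)
    then interpret polynomial_diffusion r A' \<alpha> \<beta> \<phi> T Tu Tz
      by (intro polynomial_diffusion.intro sturm_liouville_axioms)
    show ?thesis using decay_rate[OF \<Lambda> u] by simp
  qed
  then show ?thesis using \<Lambda>(1) unfolding A \<Lambda>_eq by blast
qed

end
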